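(* Let $\mathcal{P}$ be a distribution over truthful-auction requests $(v,x,p)$ with $$\beta:=\mathbb{E}_{(v,x,p)\sim\mathcal{P}}\left[\max\left(0,\,v\cdot x(v)-p(v)\right)\right]>0,$$ where $\beta$ is a constant independent of $T$. Then there is a constant $C$ depending only on $\beta$ such that for every horizon $T\ge 2$, when the requests $\gamma_1,\dots,\gamma_T$ are drawn i.i.d. from $\mathcal{P}$, the two-phase bidding algorithm Algorithm R2 (defined in the context) satisfies $$\mathrm{Regret}(\text{Algorithm R2},\mathcal{P}^T)\le C\sqrt T\log T .$$ Further, for every realization of the request sequence there is no violation of the return-on-spend constraint: the bids $b_1,\dots,b_T$ of Algorithm R2 satisfy $\sum_{t=1}^T p_t(b_t)\le\sum_{t=1}^T v_t\cdot x_t(b_t)$.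
   Context: Requests. A request is a tuple $\gamma=(v,x,p)$ with value $v\in[0,1]$, non-decreasing allocation function $x:\mathbb{R}_{\ge 0}\to[0,1]$, and payment function $p:\mathbb{R}_{\ge 0}\to[0,1]$ satisfying $p(b)=b\,x(b)-\int_0^b x(z)\,dz$ (truthful auction). Over $T$ rounds requests $\gamma_t=(v_t,x_t,p_t)$ arrive. In round $t$ the bidder sees $v_t$, chooses a bid $b_t\ge 0$, then observes $x_t(b_t)$ and $p_t(b_t)$. Put $g_t(b)=v_t\,x_t(b)-p_t(b)$. Problem. Maximize $\sum_{t=1}^T v_t x_t(b_t)$ over bids $b_t\ge0$ subject to the return-on-spend (RoS) constraint $\sum_{t=1}^T p_t(b_t)\le\sum_{t=1}^T v_t x_t(b_t)$. For a request sequence $\vec\gamma$, $\mathrm{Reward}(\mathrm{Opt},\vec\gamma)$ is the optimal (supremum) value of this problem, in hindsight. For an algorithm Alg producing bids $b_t$, $\mathrm{Reward}(\mathrm{Alg},\vec\gamma)=\sum_{t=1}^T v_t x_t(b_t)$, and $\mathrm{Regret}(\mathrm{Alg},\mathcal{P}^T)=\mathbb{E}_{\vec\gamma\sim\mathcal{P}^T}[\mathrm{Reward}(\mathrm{Opt},\vec\gamma)-\mathrm{Reward}(\mathrm{Alg},\vec\gamma)]$. Algorithm R (horizon $n$, requests indexed $1,\dots,n$). Set $\lambda_1=1$, $\alpha=1/\sqrt n$. For $t=1,\dots,n$: observe $v_t$, bid $b_t=\frac{1+\lambda_t}{\lambda_t}v_t$, compute $g_t(b_t)$, and set $\lambda_{t+1}=\lambda_t\exp(-\alpha\,g_t(b_t))$.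 Algorithm R2 (horizon $T$). First phase: starting at $t=1$, while $t\le T$ and $\sum_{i=1}^{t-1}g_i(b_i)\le 2\sqrt T\log T$, bid $b_t=v_t$ and increment $t$. Second phase: if the first phase ended after $K<T$ rounds, run Algorithm R afresh on the remaining $T-K$ requests $\gamma_{K+1},\dots,\gamma_T$ with horizon $n=T-K$. *)

theory Defs
  imports "HOL-Probability.Probability"
begin

text \<open>
  Rounds are numbered from \<open>0\<close>, so a sequence of \<open>T\<close> requests is
  \<open>\<gamma> 0, \<dots>, \<gamma> (T - 1)\<close>. Allocation and payment functions have domain
  \<open>[0, \<infinity>)\<close>; their values at negative bids are irrelevant and never used.
\<close>

type_synonym request = "real \<times> (real \<Rightarrow> real) \<times> (real \<Rightarrow> real)"

definition val :: "request \<Rightarrow> real" where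
  "val r = fst r"

definition alloc :: "request \<Rightarrow> real \<Rightarrow> real" where
  "alloc r = fst (snd r)"

definition pay :: "request \<Rightarrow> real \<Rightarrow> real" where
  "pay r = snd (snd r)"

definition truthful_request :: "request \<Rightarrow> bool" where
  "truthful_request r \<longleftrightarrow>
     val r \<in> {0..1} \<and>
     mono_on {0..} (alloc r) \<and>
     (\<forall>b\<ge>0. alloc r b \<in> {0..1}) \<and>
     (\<forall>b\<ge>0. pay r b \<in> {0..1}) \<and>
     (\<forall>b\<ge>0. pay r b = b * alloc r b - integral {0..b} (alloc r))"

text \<open>
  A distribution over requests may use any sigma-algebra for which value, allocation and
  payment are random variables. Measurability in the request and the bid jointly is needed
  because bids are themselves random, and it does not follow from measurability at each
  fixed bid, since allocation functions may jump at arbitrary points.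
\<close>

definition request_distribution :: "request measure \<Rightarrow> bool" where
  "request_distribution P \<longleftrightarrow>
     prob_space P \<and>
     (\<forall>r\<in>space P. truthful_request r) \<and>
     val \<in> borel_measurable P \<and>
     (\<lambda>(r, b). alloc r b) \<in> borel_measurable (P \<Otimes>\<^sub>M restrict_space borel {0..}) \<and>
     (\<lambda>(r, b). pay r b) \<in> borel_measurable (P \<Otimes>\<^sub>M restrict_space borel {0..})"

definition gain :: "request \<Rightarrow> real \<Rightarrow> real" where
  "gain r b = val r * alloc r b - pay r b"

definition expected_slack :: "request measure \<Rightarrow> real" where
  "expected_slack P = (LINT r|P. max 0 (val r * alloc r (val r) - pay r (val r)))"

definition reward :: "nat \<Rightarrow> (nat \<Rightarrow> request) \<Rightarrow> (nat \<Rightarrow> real) \<Rightarrow> real" where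
  "reward T \<gamma> b = (\<Sum>t<T. val (\<gamma> t) * alloc (\<gamma> t) (b t))"

definition satisfies_RoS :: "nat \<Rightarrow> (nat \<Rightarrow> request) \<Rightarrow> (nat \<Rightarrow> real) \<Rightarrow> bool" where
  "satisfies_RoS T \<gamma> b \<longleftrightarrow>
     (\<Sum>t<T. pay (\<gamma> t) (b t)) \<le> (\<Sum>t<T. val (\<gamma> t) * alloc (\<gamma> t) (b t))"

definition opt_reward :: "nat \<Rightarrow> (nat \<Rightarrow> request) \<Rightarrow> real" where
  "opt_reward T \<gamma> = Sup {reward T \<gamma> b | b. (\<forall>t<T. b t \<ge> 0) \<and> satisfies_RoS T \<gamma> b}"

text \<open>An algorithm is given by the bids it makes on each request sequence.\<close>

definition sample_regret ::
  "nat \<Rightarrow> ((nat \<Rightarrow> request) \<Rightarrow> nat \<Rightarrow> real) \<Rightarrow> (nat \<Rightarrow> request) \<Rightarrow> real" where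
  "sample_regret T alg \<gamma> = opt_reward T \<gamma> - reward T \<gamma> (alg \<gamma>)"

text \<open>
  The Bochner integral of a non-integrable function is \<open>0\<close>, so a bound on the regret
  is meaningful only together with integrability of the sample regret.
\<close>

definition regret ::
  "request measure \<Rightarrow> nat \<Rightarrow> ((nat \<Rightarrow> request) \<Rightarrow> nat \<Rightarrow> real) \<Rightarrow> real" where
  "regret P T alg = (LINT \<gamma>|(\<Pi>\<^sub>M t\<in>{..<T}. P). sample_regret T alg \<gamma>)"

primrec multiplier_R :: "nat \<Rightarrow> (nat \<Rightarrow> request) \<Rightarrow> nat \<Rightarrow> real" where
  "multiplier_R n \<gamma> 0 = 1"
| "multiplier_R n \<gamma> (Suc t) =
     (let l = multiplier_R n \<gamma> t; b = (1 + l) / l * val (\<gamma> t)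
      in l * exp (- (1 / sqrt (real n)) * gain (\<gamma> t) b))"

definition bid_R :: "nat \<Rightarrow> (nat \<Rightarrow> request) \<Rightarrow> nat \<Rightarrow> real" where
  "bid_R n \<gamma> t = (1 + multiplier_R n \<gamma> t) / multiplier_R n \<gamma> t * val (\<gamma> t)"

text \<open>
  Number of rounds of the first phase: the first \<open>k\<close> at which the loop guard
  (rounds remain, and the accumulated gain is at most the threshold) fails.
\<close>

definition first_phase_length :: "nat \<Rightarrow> (nat \<Rightarrow> request) \<Rightarrow> nat" where
  "first_phase_length T \<gamma> =
     (LEAST k. \<not> (k < T \<and>
        (\<Sum>i<k. gain (\<gamma> i) (val (\<gamma> i))) \<le> 2 * sqrt (real T) * ln (real T)))"

definition bid_R2 :: "nat \<Rightarrow> (nat \<Rightarrow> request) \<Rightarrow> nat \<Rightarrow> real" where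
  "bid_R2 T \<gamma> t =
     (let K = first_phase_length T \<gamma>
      in if t < K then val (\<gamma> t)
         else bid_R (T - K) (\<lambda>i. \<gamma> (K + i)) (t - K))"

end

theory Submission
  imports Defs
begin

text \<open>
  A bidder of value \<open>w\<close> in a truthful auction maximizes her utility by bidding \<open>w\<close>, so the bid
  \<open>(1 + \<lambda>) / \<lambda> * v\<close> of Algorithm R maximizes the Lagrangian \<open>v x(b) + \<lambda> g(b)\<close>, and the
  sum of the maximal Lagrangians at any fixed \<open>\<lambda> > 0\<close> bounds the hindsight optimum.

  Always \<open>\<lambda>\<^sub>t g\<^sub>t \<ge> -1\<close>. Hence the multiplier grows by at most \<open>2 / sqrt n\<close> per round, which
  bounds the constraint violation of Algorithm R by \<open>sqrt n ln (1 + 2 sqrt n)\<close>; the first phase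
  accumulates enough gain to pay for it. The same inequality makes the multiplicative update
  telescope, pathwise, to \<open>\<Sum> \<lambda>\<^sub>t g\<^sub>t \<le> 6 sqrt n\<close>, although \<open>\<lambda>\<^sub>t\<close> itself may be large.

  Since \<open>\<lambda>\<^sub>t\<close> depends on earlier requests only, the expected Lagrangian of every round of the
  second phase is at least the infimum over \<open>\<lambda>\<close> of the expected Lagrangian. The regret is thus
  at most a constant per round of the first phase plus \<open>6 sqrt T\<close>, and by Wald's identity the
  first phase has expected length at most \<open>(2 sqrt T ln T + 1) / \<beta>\<close>.

  The hindsight optimum is a supremum over uncountably many bids. It is measurable because
  countably many measurable bidding rules suffice to approximate it.
\<close>

section \<open>Truthful auctions\<close>

text \<open>By the payment formula, the utility lost by bidding \<open>b\<close> instead of the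
  value \<open>w\<close> is the oriented integral from \<open>b\<close> to \<open>w\<close> of
  \<open>alloc r z - alloc r b\<close>. Monotonicity makes it nonnegative on either side of
  \<open>w\<close>.\<close>

lemma truthful_bid_optimal:
  assumes r: "truthful_request r" and w: "w \<ge> 0" and b: "b \<ge> 0"
  shows "w * alloc r b - pay r b \<le> w * alloc r w - pay r w"
proof -
  let ?x = "alloc r"
  have mono: "\<And>c d. 0 \<le> c \<Longrightarrow> c \<le> d \<Longrightarrow> ?x c \<le> ?x d"
    using r unfolding truthful_request_def mono_on_def by auto
  have int: "?x integrable_on {c..d}" if "0 \<le> c" for c d
    by (rule integrable_on_mono_on) (use mono that in \<open>auto simp: mono_on_def\<close>)
  have pay: "pay r c = c * ?x c - integral {0..c} ?x" if "c \<ge> 0" for c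
    using r that unfolding truthful_request_def by auto
  show ?thesis
  proof (cases "b \<le> w")
    case True
    have "integral {0..b} ?x + integral {b..w} ?x = integral {0..w} ?x"
      using int b True by (intro Henstock_Kurzweil_Integration.integral_combine) auto
    moreover have "integral {b..w} (\<lambda>_. ?x b) \<le> integral {b..w} ?x"
      using mono b int by (intro integral_le) auto
    ultimately show ?thesis
      using True pay[OF b] pay[OF w] by (simp add: algebra_simps)
  next
    case False
    have "integral {0..w} ?x + integral {w..b} ?x = integral {0..b} ?x"
      using int w False by (intro Henstock_Kurzweil_Integration.integral_combine) auto
    moreover have "integral {w..b} ?x \<le> integral {w..b} (\<lambda>_. ?x b)"
      using mono w int by (intro integral_le) auto
    ultimately show ?thesis
      using False pay[OF b] pay[OF w] by (simp add: algebra_simps)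
  qed
qed

text \<open>The payment formula makes a bid of 0 free, and the truthful bid does no worse than
  that.\<close>

lemma truthful_utility_nonneg:
  assumes r: "truthful_request r" and w: "w \<ge> 0"
  shows "0 \<le> w * alloc r w - pay r w"
proof -
  have "pay r 0 = 0" "0 \<le> alloc r 0"
    using r unfolding truthful_request_def by auto
  then have "0 \<le> w * alloc r 0 - pay r 0"
    using w by simp
  also have "\<dots> \<le> w * alloc r w - pay r w"
    by (rule truthful_bid_optimal[OF r w]) simp
  finally show ?thesis .
qed

lemma truthful_val: "truthful_request r \<Longrightarrow> 0 \<le> val r \<and> val r \<le> 1"
  by (simp add: truthful_request_def)

lemma truthful_alloc: "truthful_request r \<Longrightarrow> b \<ge> 0 \<Longrightarrow> 0 \<le> alloc r b \<and> alloc r b \<le> 1"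
  by (simp add: truthful_request_def)

lemma truthful_pay: "truthful_request r \<Longrightarrow> b \<ge> 0 \<Longrightarrow> 0 \<le> pay r b \<and> pay r b \<le> 1"
  unfolding truthful_request_def atLeastAtMost_iff by blast

lemma truthful_mono: "truthful_request r \<Longrightarrow> 0 \<le> a \<Longrightarrow> a \<le> b \<Longrightarrow> alloc r a \<le> alloc r b"
  unfolding truthful_request_def mono_on_def by auto

lemma truthful_value:
  assumes "truthful_request r" "b \<ge> 0"
  shows "0 \<le> val r * alloc r b \<and> val r * alloc r b \<le> 1"
  using truthful_val[OF assms(1)] truthful_alloc[OF assms] by (simp add: mult_le_one)

lemma truthful_gain:
  assumes "truthful_request r" "b \<ge> 0"
  shows "-1 \<le> gain r b \<and> gain r b \<le> 1"
  using truthful_value[OF assms] truthful_pay[OF assms] unfolding gain_def by linarith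

lemma truthful_gain_val:
  assumes r: "truthful_request r"
  shows "0 \<le> gain r (val r)"
  using truthful_utility_nonneg[OF r, of "val r"] truthful_val[OF r] by (simp add: gain_def)

text \<open>The gain at bid \<open>c\<close> is the utility of a bidder with value \<open>a\<close>
  minus \<open>(a - val r) * alloc r c\<close>. Moving from \<open>a\<close> to \<open>b\<close>
  lowers the first term by truthfulness and raises the subtracted one by monotonicity.\<close>

lemma truthful_gain_antimono:
  assumes r: "truthful_request r" and "val r \<le> a" "a \<le> b"
  shows "gain r b \<le> gain r a"
proof -
  have a: "0 \<le> a"
    using truthful_val[OF r] assms by linarith
  have "a * alloc r b - pay r b \<le> a * alloc r a - pay r a"
    using truthful_bid_optimal[OF r, of a b] a assms by auto
  moreover have "(a - val r) * alloc r a \<le> (a - val r) * alloc r b"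
    using truthful_mono[OF r a, of b] assms by (intro mult_left_mono) auto
  ultimately show ?thesis
    unfolding gain_def by (simp add: algebra_simps)
qed

section \<open>Maximal Lagrangians and weak duality\<close>

definition shaded_bid :: "real \<Rightarrow> request \<Rightarrow> real" where
  "shaded_bid l r = (1 + l) / l * val r"

text \<open>The Lagrangian already maximized over the bid:
  \<open>val r * alloc r b + l * gain r b\<close> equals \<open>l\<close> times the utility at
  \<open>b\<close> of a bidder whose value is \<open>shaded_bid l r\<close>, so truthfulness makes
  that bid optimal.\<close>

definition lagrangian :: "real \<Rightarrow> request \<Rightarrow> real" where
  "lagrangian l r = val r * alloc r (shaded_bid l r) + l * gain r (shaded_bid l r)"

lemma shaded_bid_nonneg: "truthful_request r \<Longrightarrow> l > 0 \<Longrightarrow> 0 \<le> shaded_bid l r"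
  using truthful_val[of r] by (simp add: shaded_bid_def)

lemma lagrangian_maximal:
  assumes r: "truthful_request r" and l: "l > 0" and b: "b \<ge> 0"
  shows "val r * alloc r b + l * gain r b \<le> lagrangian l r"
proof -
  let ?w = "shaded_bid l r"
  have *: "val r * alloc r c + l * gain r c = l * (?w * alloc r c - pay r c)" for c
    using l by (simp add: gain_def shaded_bid_def field_simps)
  have "l * (?w * alloc r b - pay r b) \<le> l * (?w * alloc r ?w - pay r ?w)"
    using truthful_bid_optimal[OF r shaded_bid_nonneg[OF r l] b] l by (simp add: mult_left_mono)
  then show ?thesis
    unfolding lagrangian_def * .
qed

lemma lagrangian_bounds:
  assumes r: "truthful_request r" and l: "l > 0"
  shows "0 \<le> lagrangian l r \<and> lagrangian l r \<le> 1 + l"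
proof
  have "0 \<le> val r * alloc r (val r)"
    using truthful_value[OF r] truthful_val[OF r] by blast
  then have "0 \<le> val r * alloc r (val r) + l * gain r (val r)"
    using truthful_gain_val[OF r] l by simp
  also have "\<dots> \<le> lagrangian l r"
    using lagrangian_maximal[OF r l] truthful_val[OF r] by blast
  finally show "0 \<le> lagrangian l r" .
  show "lagrangian l r \<le> 1 + l"
    using truthful_value[OF r shaded_bid_nonneg[OF r l]] truthful_gain[OF r shaded_bid_nonneg[OF r l]] l
    unfolding lagrangian_def by (intro add_mono) auto
qed

text \<open>The maximal Lagrangian is nonnegative and its value part is at most 1. A large
  multiplier therefore forces any loss of the round to be small.\<close>

lemma shaded_bid_gain_lower:
  assumes r: "truthful_request r" and l: "l > 0"
  shows "- 1 \<le> l * gain r (shaded_bid l r)"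
  using lagrangian_bounds[OF r l] truthful_value[OF r shaded_bid_nonneg[OF r l]]
  unfolding lagrangian_def by linarith

lemma satisfies_RoS_iff_gain:
  "satisfies_RoS T \<gamma> b \<longleftrightarrow> 0 \<le> (\<Sum>t<T. gain (\<gamma> t) (b t))"
  by (simp add: satisfies_RoS_def gain_def sum_subtractf)

lemma value_bids_feasible:
  assumes "\<forall>t<T. truthful_request (\<gamma> t)"
  shows "\<forall>t<T. 0 \<le> val (\<gamma> t)" "satisfies_RoS T \<gamma> (\<lambda>t. val (\<gamma> t))"
  unfolding satisfies_RoS_iff_gain
  by (use assms truthful_val in blast, rule sum_nonneg, use assms truthful_gain_val in simp)

lemma feasible_rewards_nonempty:
  assumes "\<forall>t<T. truthful_request (\<gamma> t)"
  shows "{reward T \<gamma> b |b. (\<forall>t<T. 0 \<le> b t) \<and> satisfies_RoS T \<gamma> b} \<noteq> {}"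
proof -
  have "reward T \<gamma> (\<lambda>t. val (\<gamma> t)) \<in> {reward T \<gamma> b |b. (\<forall>t<T. 0 \<le> b t) \<and> satisfies_RoS T \<gamma> b}"
    using value_bids_feasible[OF assms] by (intro CollectI exI[of _ "\<lambda>t. val (\<gamma> t)"]) simp
  then show ?thesis
    by (metis empty_iff)
qed

text \<open>Weak duality: feasibility means that the total gain is nonnegative, so adding
  \<open>l\<close> times it can only increase the reward, and then each round is maximized
  separately.\<close>

lemma reward_le_lagrangian:
  assumes "\<forall>t<T. truthful_request (\<gamma> t)" and l: "l > 0"
    and b: "\<forall>t<T. 0 \<le> b t" "satisfies_RoS T \<gamma> b"
  shows "reward T \<gamma> b \<le> (\<Sum>t<T. lagrangian l (\<gamma> t))"
proof -
  have "reward T \<gamma> b \<le> reward T \<gamma> b + l * (\<Sum>t<T. gain (\<gamma> t) (b t))"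
    using b l by (simp add: satisfies_RoS_iff_gain)
  also have "\<dots> = (\<Sum>t<T. val (\<gamma> t) * alloc (\<gamma> t) (b t) + l * gain (\<gamma> t) (b t))"
    by (simp add: reward_def sum.distrib sum_distrib_left)
  also have "\<dots> \<le> (\<Sum>t<T. lagrangian l (\<gamma> t))"
    by (rule sum_mono, rule lagrangian_maximal) (use assms in simp_all)
  finally show ?thesis .
qed

lemma opt_reward_le_lagrangian:
  assumes "\<forall>t<T. truthful_request (\<gamma> t)" and l: "l > 0"
  shows "opt_reward T \<gamma> \<le> (\<Sum>t<T. lagrangian l (\<gamma> t))"
  unfolding opt_reward_def
proof (rule cSup_least)
  show "{reward T \<gamma> b |b. (\<forall>t<T. 0 \<le> b t) \<and> satisfies_RoS T \<gamma> b} \<noteq> {}"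
    by (rule feasible_rewards_nonempty[OF assms(1)])
next
  fix y assume "y \<in> {reward T \<gamma> b |b. (\<forall>t<T. 0 \<le> b t) \<and> satisfies_RoS T \<gamma> b}"
  then obtain b where "y = reward T \<gamma> b" "\<forall>t<T. 0 \<le> b t" "satisfies_RoS T \<gamma> b"
    by blast
  then show "y \<le> (\<Sum>t<T. lagrangian l (\<gamma> t))"
    using reward_le_lagrangian[OF assms] by simp
qed

lemma opt_reward_upper:
  assumes "\<forall>t<T. truthful_request (\<gamma> t)"
    and b: "\<forall>t<T. 0 \<le> b t" "satisfies_RoS T \<gamma> b"
  shows "reward T \<gamma> b \<le> opt_reward T \<gamma>"
  unfolding opt_reward_def
proof (rule cSup_upper)
  show "bdd_above {reward T \<gamma> b |b. (\<forall>t<T. 0 \<le> b t) \<and> satisfies_RoS T \<gamma> b}"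
    by (rule bdd_aboveI[where M = "\<Sum>t<T. lagrangian 1 (\<gamma> t)"])
      (use reward_le_lagrangian[OF assms(1) zero_less_one] in auto)
qed (intro CollectI exI[of _ b] conjI refl b)

lemma reward_bounds:
  assumes "\<forall>t<T. truthful_request (\<gamma> t)" "\<forall>t<T. 0 \<le> b t"
  shows "0 \<le> reward T \<gamma> b \<and> reward T \<gamma> b \<le> real T"
proof
  show "0 \<le> reward T \<gamma> b"
    unfolding reward_def
  proof (rule sum_nonneg)
    fix t assume "t \<in> {..<T}"
    then show "0 \<le> val (\<gamma> t) * alloc (\<gamma> t) (b t)"
      using assms truthful_value[of "\<gamma> t" "b t"] by simp
  qed
  have "reward T \<gamma> b \<le> (\<Sum>t<T. 1)"
    unfolding reward_def
  proof (rule sum_mono)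
    fix t assume "t \<in> {..<T}"
    then show "val (\<gamma> t) * alloc (\<gamma> t) (b t) \<le> 1"
      using assms truthful_value[of "\<gamma> t" "b t"] by simp
  qed
  then show "reward T \<gamma> b \<le> real T"
    by simp
qed

lemma opt_reward_bounds:
  assumes "\<forall>t<T. truthful_request (\<gamma> t)"
  shows "0 \<le> opt_reward T \<gamma> \<and> opt_reward T \<gamma> \<le> real T"
proof
  show "0 \<le> opt_reward T \<gamma>"
  proof -
    let ?b = "\<lambda>t. val (\<gamma> t)"
    have b: "\<forall>t<T. 0 \<le> ?b t" "satisfies_RoS T \<gamma> ?b"
      using value_bids_feasible[OF assms] by auto
    have "0 \<le> reward T \<gamma> ?b"
      using reward_bounds[OF assms b(1)] by blast
    also have "\<dots> \<le> opt_reward T \<gamma>"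
      by (rule opt_reward_upper[OF assms b])
    finally show ?thesis .
  qed
  show "opt_reward T \<gamma> \<le> real T"
    unfolding opt_reward_def
  proof (rule cSup_least)
    show "{reward T \<gamma> b |b. (\<forall>t<T. 0 \<le> b t) \<and> satisfies_RoS T \<gamma> b} \<noteq> {}"
      by (rule feasible_rewards_nonempty[OF assms(1)])
  qed (use reward_bounds[OF assms] in auto)
qed

section \<open>Pathwise analysis of Algorithm R\<close>

lemma multiplier_R_pos: "0 < multiplier_R n \<gamma> t"
  by (induction t) (auto simp: Let_def)

lemma bid_R_eq_shaded_bid: "bid_R n \<gamma> t = shaded_bid (multiplier_R n \<gamma> t) (\<gamma> t)"
  by (simp add: bid_R_def shaded_bid_def)

lemma multiplier_R_Suc:
  "multiplier_R n \<gamma> (Suc t) =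
     multiplier_R n \<gamma> t * exp (- (gain (\<gamma> t) (bid_R n \<gamma> t) / sqrt (real n)))"
  by (simp add: bid_R_def Let_def)

text \<open>Unrolling the update turns an upper bound on the multiplier into a lower bound on the
  accumulated gain.\<close>

lemma multiplier_R_eq_exp:
  "multiplier_R n \<gamma> t = exp (- ((\<Sum>i<t. gain (\<gamma> i) (bid_R n \<gamma> i)) / sqrt (real n)))"
proof (induction t)
  case (Suc t)
  then show ?case
    by (simp only: multiplier_R_Suc) (simp add: add_divide_distrib flip: exp_add)
qed simp

lemma multiplier_R_cong:
  assumes "\<And>i. i < t \<Longrightarrow> \<gamma> i = \<gamma>' i"
  shows "multiplier_R n \<gamma> t = multiplier_R n \<gamma>' t"
  using assms by (induction t) (auto simp: Let_def)

lemma exp_le_one_plus_twice: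
  fixes y :: real
  assumes "0 \<le> y" "y \<le> 1"
  shows "exp y \<le> 1 + 2 * y"
proof -
  have "exp y \<le> 1 + y + y\<^sup>2"
    using assms by (rule exp_bound)
  also have "y\<^sup>2 \<le> y"
    using assms by (simp add: power2_eq_square mult_left_le)
  finally show ?thesis
    by simp
qed

text \<open>The difference of the two sides vanishes at 0 and has derivative
  \<open>exp (- z) - (1 - z)\<close>, which is nonnegative.\<close>

lemma exp_minus_le:
  fixes y :: real
  assumes "0 \<le> y"
  shows "exp (- y) \<le> 1 - y + y\<^sup>2 / 2"
proof -
  have "\<exists>D. ((\<lambda>z. 1 - z + z\<^sup>2 / 2 - exp (- z)) has_real_derivative D) (at z) \<and> 0 \<le> D" for z :: real
    using exp_ge_add_one_self[of "- z"]
    by (intro exI[of _ "- 1 + z + exp (- z)"] conjI) (auto intro!: derivative_eq_intros)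
  from DERIV_nonneg_imp_nondecreasing[OF assms this] show ?thesis
    by simp
qed

text \<open>A multiplicative update could grow exponentially, but here the increase is at most about
  the step size times multiplier times loss, and the product of multiplier and loss never exceeds 1.
  Growth is thus additive.\<close>

lemma multiplier_R_linear_growth:
  assumes r: "\<forall>t<n. truthful_request (\<gamma> t)" and "t \<le> n"
  shows "multiplier_R n \<gamma> t \<le> 1 + 2 * (real t / sqrt (real n))"
  using \<open>t \<le> n\<close>
proof (induction t)
  case (Suc t)
  let ?l = "multiplier_R n \<gamma> t" and ?g = "gain (\<gamma> t) (bid_R n \<gamma> t)" and ?a = "1 / sqrt (real n)"
  have l: "0 < ?l"
    by (rule multiplier_R_pos)
  have a: "0 \<le> ?a" "?a \<le> 1"
    using Suc.prems by (auto simp: divide_simps)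
  have tr: "truthful_request (\<gamma> t)"
    using r Suc.prems by simp
  have g: "- 1 \<le> ?g" "- 1 \<le> ?l * ?g"
    using truthful_gain[OF tr shaded_bid_nonneg[OF tr l]] shaded_bid_gain_lower[OF tr l]
    by (simp_all add: bid_R_eq_shaded_bid)
  \<comment> \<open>The loss of the round; a nonnegative gain does not raise the multiplier, so it
    counts as loss 0.\<close>
  define y where "y = max 0 (- ?g)"
  have y: "0 \<le> y" "y \<le> 1" "?l * y \<le> 1" "- ?g \<le> y"
    using g l by (auto simp: y_def max_def)
  have ay: "0 \<le> ?a * y" "?a * y \<le> 1"
    using a y mult_le_one[of ?a y] by auto
  have "multiplier_R n \<gamma> (Suc t) \<le> ?l * exp (?a * y)"
    unfolding multiplier_R_Suc using l y(4) a(1)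
    by (auto intro!: mult_left_mono simp: divide_simps)
  also have "\<dots> \<le> ?l * (1 + 2 * (?a * y))"
    using exp_le_one_plus_twice[OF ay] l by (intro mult_left_mono) auto
  also have "\<dots> = ?l + 2 * (?a * (?l * y))"
    by (simp add: algebra_simps)
  also have "?a * (?l * y) \<le> ?a"
    using mult_left_mono[OF y(3) a(1)] by simp
  finally have "multiplier_R n \<gamma> (Suc t) \<le> ?l + 2 * ?a"
    by simp
  with Suc show ?case
    by (simp add: add_divide_distrib)
qed simp

lemma sum_gain_R_lower:
  assumes r: "\<forall>t<n. truthful_request (\<gamma> t)" and n: "n > 0"
  shows "- (sqrt (real n) * ln (1 + 2 * sqrt (real n))) \<le> (\<Sum>t<n. gain (\<gamma> t) (bid_R n \<gamma> t))"
proof -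
  let ?S = "\<Sum>t<n. gain (\<gamma> t) (bid_R n \<gamma> t)"
  have "exp (- (?S / sqrt (real n))) \<le> 1 + 2 * sqrt (real n)"
    using multiplier_R_linear_growth[OF r, of n] n
    by (simp flip: multiplier_R_eq_exp add: real_div_sqrt)
  then have "- (?S / sqrt (real n)) \<le> ln (1 + 2 * sqrt (real n))"
    by (subst ln_ge_iff) (auto simp: add_pos_nonneg)
  then show ?thesis
    using n by (simp add: field_simps)
qed

text \<open>One update as a potential argument. For \<open>G >= 0\<close> the second-order term is
  at most \<open>L * a\<^sup>2 * G / 2\<close>, and since \<open>L\<close> may be large it is
  absorbed by the factor \<open>1 - a / 2\<close>. For \<open>G < 0\<close> the bound
  \<open>- 1 <= L * G\<close> limits the second-order error to \<open>a\<^sup>2\<close>, and the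
  same factor costs at most another \<open>a\<^sup>2 / 2\<close>.\<close>

lemma multiplier_step:
  fixes a L G :: real
  assumes a: "0 < a" "a \<le> 1" and L: "0 < L" and G: "- 1 \<le> G" "G \<le> 1" "- 1 \<le> L * G"
  shows "a * ((1 - a / 2) * (L * G)) \<le> L - L * exp (- (a * G)) + 2 * a\<^sup>2"
proof (cases "G \<ge> 0")
  case True
  have "G * G \<le> G * 1"
    using True G by (intro mult_left_mono) auto
  from mult_left_mono[OF this, of "a\<^sup>2"] have "(a * G)\<^sup>2 \<le> a\<^sup>2 * G"
    by (simp add: power2_eq_square mult_ac)
  moreover have "exp (- (a * G)) \<le> 1 - a * G + (a * G)\<^sup>2 / 2"
    using a True by (intro exp_minus_le) auto
  ultimately have "exp (- (a * G)) \<le> 1 - a * G + a\<^sup>2 * G / 2"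
    by linarith
  then have "L * exp (- (a * G)) \<le> L * (1 - a * G + a\<^sup>2 * G / 2)"
    using L by simp
  moreover have "L * (1 - a * G + a\<^sup>2 * G / 2) = L - a * ((1 - a / 2) * (L * G))"
    by (simp add: algebra_simps power2_eq_square)
  moreover have "0 \<le> a\<^sup>2"
    by simp
  ultimately show ?thesis
    by linarith
next
  case False
  have "a * - G \<le> 1 * 1"
    using a G False by (intro mult_mono) auto
  then have "exp (a * - G) \<le> 1 + a * - G + (a * - G)\<^sup>2"
    using a False by (intro exp_bound) (auto simp: mult_nonneg_nonpos)
  then have "L * exp (- (a * G)) \<le> L * (1 - a * G + (a * G)\<^sup>2)"
    using L by simp
  moreover have "L * (1 - a * G + (a * G)\<^sup>2) = L - a * (L * G) + a\<^sup>2 * ((L * - G) * - G)"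
    by (simp add: algebra_simps power2_eq_square)
  moreover have "a\<^sup>2 * ((L * - G) * - G) \<le> a\<^sup>2 * (1 * 1)"
    using G False L by (intro mult_left_mono mult_mono) (auto simp: mult_nonneg_nonpos)
  moreover have "a\<^sup>2 * (- (L * G)) \<le> a\<^sup>2 * 1"
    using G by (intro mult_left_mono) auto
  moreover have "a * ((1 - a / 2) * (L * G)) = a * (L * G) + a\<^sup>2 * (- (L * G)) / 2"
    by (simp add: algebra_simps power2_eq_square)
  moreover have "0 \<le> a\<^sup>2"
    by simp
  ultimately show ?thesis
    by linarith
qed

lemma sum_multiplier_gain_R_upper:
  assumes r: "\<forall>t<n. truthful_request (\<gamma> t)"
  shows "(\<Sum>t<n. multiplier_R n \<gamma> t * gain (\<gamma> t) (bid_R n \<gamma> t)) \<le> 6 * sqrt (real n)"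
proof (cases "n = 0")
  case False
  let ?l = "multiplier_R n \<gamma>" and ?g = "\<lambda>t. gain (\<gamma> t) (bid_R n \<gamma> t)"
  define a where "a = 1 / sqrt (real n)"
  have a: "0 < a" "a \<le> 1"
    using False by (auto simp: a_def divide_simps)
  have step: "a * ((1 - a / 2) * (?l t * ?g t)) \<le> (?l t - ?l (Suc t)) + 2 * a\<^sup>2" if "t < n" for t
  proof -
    have l: "0 < ?l t"
      by (rule multiplier_R_pos)
    have tr: "truthful_request (\<gamma> t)"
      using r that by simp
    have g: "- 1 \<le> ?g t" "?g t \<le> 1" "- 1 \<le> ?l t * ?g t"
      using truthful_gain[OF tr shaded_bid_nonneg[OF tr l]] shaded_bid_gain_lower[OF tr l]
      by (simp_all add: bid_R_eq_shaded_bid)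
    show ?thesis
      using multiplier_step[OF a l g] unfolding multiplier_R_Suc by (simp add: a_def)
  qed
  define S where "S = (\<Sum>t<n. ?l t * ?g t)"
  have "a * ((1 - a / 2) * S) = (\<Sum>t<n. a * ((1 - a / 2) * (?l t * ?g t)))"
    by (simp add: S_def sum_distrib_left)
  also have "\<dots> \<le> (\<Sum>t<n. (?l t - ?l (Suc t)) + 2 * a\<^sup>2)"
    using step by (intro sum_mono) auto
  also have "\<dots> = 1 - ?l n + 2 * (real n * a\<^sup>2)"
    by (simp add: sum.distrib sum_lessThan_telescope' del: multiplier_R.simps(2))
  also have "real n * a\<^sup>2 = 1"
    using False by (simp add: a_def power_divide)
  \<comment> \<open>The initial multiplier contributes 1 and the second-order errors contribute 2;
    the final multiplier is positive and is dropped.\<close>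
  also have "1 - ?l n + 2 * 1 \<le> 3"
    using multiplier_R_pos[of n \<gamma> n] by simp
  finally have "(1 - a / 2) * S \<le> 3 / a"
    using a by (simp add: field_simps)
  then have S: "(1 - a / 2) * S \<le> 3 * sqrt (real n)"
    by (simp add: a_def)
  \<comment> \<open>Since \<open>a <= 1\<close>, the factor \<open>1 - a / 2\<close> is at least
    1/2, which doubles the constant 3 when \<open>S\<close> is positive.\<close>
  have "S \<le> 6 * sqrt (real n)"
  proof (cases "S \<le> 0")
    case True
    then show ?thesis
      by (smt (verit) real_sqrt_ge_zero of_nat_0_le_iff)
  next
    case False
    have "S / 2 \<le> (1 - a / 2) * S"
      using False a mult_right_mono[of "1/2" "1 - a/2" S] by simp
    then show ?thesis
      using S by simp
  qed
  then show ?thesis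
    by (simp add: S_def)
qed simp

section \<open>Measurability of the hindsight optimum\<close>

text \<open>For a truthful request and \<open>s >= 0\<close> this is the infimum of the superlevel
  set of the allocation at level \<open>q\<close>, capped at \<open>s\<close>. Running over rational
  bids with default \<open>s\<close> keeps it a countable infimum of measurable functions, also when
  the superlevel set is empty.\<close>

definition threshold_bid :: "real \<Rightarrow> real \<Rightarrow> request \<Rightarrow> real" where
  "threshold_bid q s r = (INF z\<in>\<rat> \<inter> {0..}. if q \<le> alloc r z then z else s)"

text \<open>Three kinds of rules: bidding the value, constant rational bids (levels
  \<open>q > 1\<close>, which no allocation reaches), and bids at jumps of the allocation.\<close>

definition selectors :: "(request \<Rightarrow> real) set" where
  "selectors = insert val ((\<lambda>(q, s). threshold_bid q s) ` (\<rat> \<times> (\<rat> \<inter> {0..})))"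

lemma countable_selectors: "countable selectors"
  unfolding selectors_def by (intro countable_insert countable_image countable_SIGMA countable_Int1 countable_rat)

lemma rat_nonneg_nonempty: "\<rat> \<inter> {0::real..} \<noteq> {}"
  using Rats_0 by force

lemma threshold_bid_bdd: "0 \<le> s \<Longrightarrow> bdd_below ((\<lambda>z. if q \<le> alloc r z then z else s) ` (\<rat> \<inter> {0..}))"
  by (rule bdd_belowI[of _ 0]) auto

lemma threshold_bid_nonneg: "0 \<le> s \<Longrightarrow> 0 \<le> threshold_bid q s r"
  unfolding threshold_bid_def by (intro cINF_greatest rat_nonneg_nonempty) auto

lemma threshold_bid_unreachable:
  assumes r: "truthful_request r" and q: "1 < q"
  shows "threshold_bid q s r = s"
proof -
  have "(if q \<le> alloc r z then z else s) = s" if "z \<in> \<rat> \<inter> {0..}" for z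
    using truthful_alloc[OF r, of z] that q by auto
  then show ?thesis
    unfolding threshold_bid_def by (subst INF_cong[OF refl, of _ _ "\<lambda>_. s"]) (use rat_nonneg_nonempty in auto)
qed

text \<open>Rationals below \<open>b\<close> miss the level and contribute \<open>s\<close>, which
  is at least \<open>b\<close>; rationals above \<open>b\<close> reach it and come arbitrarily close
  to \<open>b\<close>.\<close>

lemma threshold_bid_jump:
  assumes r: "truthful_request r" and b: "0 \<le> b" "b \<le> s" and "q \<le> alloc r b"
    and below: "\<And>c. 0 \<le> c \<Longrightarrow> c < b \<Longrightarrow> alloc r c < q"
  shows "threshold_bid q s r = b"
proof (rule antisym)
  show "b \<le> threshold_bid q s r"
    unfolding threshold_bid_def
  proof (rule cINF_greatest[OF rat_nonneg_nonempty])
    fix z :: real assume "z \<in> \<rat> \<inter> {0..}"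
    then show "b \<le> (if q \<le> alloc r z then z else s)"
      using below[of z] b by (auto simp: not_less[symmetric])
  qed
  show "threshold_bid q s r \<le> b"
  proof (rule dense_ge)
    fix y assume "b < y"
    then obtain z where z: "z \<in> \<rat>" "b < z" "z < y"
      using Rats_dense_in_real by blast
    have "q \<le> alloc r z"
      using truthful_mono[OF r b(1), of z] z assms by linarith
    then have "threshold_bid q s r \<le> z"
      unfolding threshold_bid_def
      using z b by (intro cINF_lower2[OF threshold_bid_bdd, of s z]) auto
    then show "threshold_bid q s r \<le> y"
      using z by simp
  qed
qed

text \<open>
  Above the value, lowering the bid can only increase the gain, so a bid at which the
  allocation is left-continuous may be replaced by a slightly smaller rational bid. The
  remaining bids are jumps of the allocation, and those are infima of its superlevel sets.
\<close>

lemma selectors_approximate: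
  assumes r: "truthful_request r" and b: "0 \<le> b" and e: "0 < e"
  shows "\<exists>f\<in>selectors. gain r b \<le> gain r (f r) \<and> val r * alloc r b \<le> val r * alloc r (f r) + e"
proof -
  note v = truthful_val[OF r]
  show ?thesis
  proof (cases "b \<le> val r")
    case True
    \<comment> \<open>Raising a bid up to the value improves both gain and allocation.\<close>
    have "gain r b \<le> gain r (val r)"
      unfolding gain_def using truthful_bid_optimal[OF r _ b, of "val r"] v by simp
    moreover have "val r * alloc r b \<le> val r * alloc r (val r)"
      using truthful_mono[OF r b True] v by (intro mult_left_mono) auto
    ultimately show ?thesis
      using e by (intro bexI[of _ val]) (auto simp: selectors_def)
  next
    case False
    show ?thesis
    proof (cases "\<exists>c. val r \<le> c \<and> c < b \<and> alloc r b - e < alloc r c")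
      case True
      then obtain c where c: "val r \<le> c" "c < b" "alloc r b - e < alloc r c"
        by blast
      obtain z where z: "z \<in> \<rat>" "c < z" "z < b"
        using Rats_dense_in_real[OF c(2)] by blast
      have z0: "0 \<le> z"
        using c z v by linarith
      have "gain r b \<le> gain r z"
        using c z by (intro truthful_gain_antimono[OF r]) auto
      moreover have "alloc r b \<le> alloc r z + e"
        using truthful_mono[OF r, of c z] c z v by auto
      then have "val r * alloc r b \<le> val r * alloc r z + val r * e"
        using v mult_left_mono[of "alloc r b" "alloc r z + e" "val r"] by (simp add: distrib_left)
      moreover have "val r * e \<le> e"
        using v e by (simp add: mult_left_le_one_le)
      moreover have "threshold_bid 2 z r = z"
        by (rule threshold_bid_unreachable[OF r]) simp
      moreover have "threshold_bid 2 z \<in> selectors"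
        using z z0 unfolding selectors_def by force
      ultimately show ?thesis
        by (intro bexI[of _ "threshold_bid 2 z"]) auto
    next
      case nojump: False
      \<comment> \<open>Every bid between the value and \<open>b\<close> has allocation at most
        \<open>alloc r b - e\<close>, so a rational level in this gap identifies \<open>b\<close>
        exactly.\<close>
      obtain q where q: "q \<in> \<rat>" "alloc r b - e < q" "q < alloc r b"
        using Rats_dense_in_real[of "alloc r b - e" "alloc r b"] e by auto
      obtain s where s: "s \<in> \<rat>" "b < s"
        using Rats_dense_in_real[of b "b + 1"] by auto
      have "threshold_bid q s r = b"
      proof (rule threshold_bid_jump[OF r b])
        fix c assume c: "0 \<le> c" "c < b"
        \<comment> \<open>The absence of a close allocation is known only from the value upwards;
          monotonicity carries it to smaller bids.\<close>
        have "alloc r c \<le> alloc r (max c (val r))"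
          using c by (intro truthful_mono[OF r]) auto
        also have "\<dots> \<le> alloc r b - e"
          using nojump c False by (meson linorder_not_le max.cobounded2 max_less_iff_conj)
        finally show "alloc r c < q"
          using q by simp
      qed (use s q in auto)
      moreover have "threshold_bid q s \<in> selectors"
        using q s b unfolding selectors_def by force
      ultimately show ?thesis
        using e by (intro bexI[of _ "threshold_bid q s"]) auto
    qed
  qed
qed

lemma selectors_nonneg:
  assumes "truthful_request r" "f \<in> selectors"
  shows "0 \<le> f r"
  using assms truthful_val[OF assms(1)] threshold_bid_nonneg[where r = r] unfolding selectors_def by auto

text \<open>Approximating each bid by a selector never lowers a gain, so feasibility is preserved
  exactly and only the reward suffers a small error. The default 0 for infeasible rules cannot raise
  the supremum above the optimum, which is nonnegative.\<close>

lemma opt_reward_eq_SUP_selectors: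
  assumes \<gamma>: "\<forall>t<T. truthful_request (\<gamma> t)"
  shows "opt_reward T \<gamma> =
    (SUP F\<in>{..<T} \<rightarrow>\<^sub>E selectors.
       if satisfies_RoS T \<gamma> (\<lambda>t. F t (\<gamma> t)) then reward T \<gamma> (\<lambda>t. F t (\<gamma> t)) else 0)"
    (is "_ = (SUP F\<in>?S. ?h F)")
    and "bdd_above ((\<lambda>F. if satisfies_RoS T \<gamma> (\<lambda>t. F t (\<gamma> t)) then reward T \<gamma> (\<lambda>t. F t (\<gamma> t)) else 0)
       ` ({..<T} \<rightarrow>\<^sub>E selectors))"
proof -
  have upper: "?h F \<le> opt_reward T \<gamma>" if "F \<in> ?S" for F
  proof -
    have "\<forall>t<T. 0 \<le> F t (\<gamma> t)"
      using that \<gamma> selectors_nonneg by (auto simp: PiE_iff simp del: split_paired_All)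
    then show ?thesis
      using opt_reward_upper[OF \<gamma>] opt_reward_bounds[OF \<gamma>] by auto
  qed
  show bdd: "bdd_above (?h ` ?S)"
    by (rule bdd_aboveI2[OF upper])
  have ne: "?S \<noteq> {}"
    by (auto simp: PiE_eq_empty_iff selectors_def)
  show "opt_reward T \<gamma> = (SUP F\<in>?S. ?h F)"
  proof (rule antisym)
    show "opt_reward T \<gamma> \<le> (SUP F\<in>?S. ?h F)"
      unfolding opt_reward_def
    proof (rule cSup_least)
      show "{reward T \<gamma> b |b. (\<forall>t<T. 0 \<le> b t) \<and> satisfies_RoS T \<gamma> b} \<noteq> {}"
        by (rule feasible_rewards_nonempty[OF \<gamma>])
      fix y assume "y \<in> {reward T \<gamma> b |b. (\<forall>t<T. 0 \<le> b t) \<and> satisfies_RoS T \<gamma> b}"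
      then obtain b where y: "y = reward T \<gamma> b" and b: "\<forall>t<T. 0 \<le> b t" "satisfies_RoS T \<gamma> b"
        by blast
      show "y \<le> (SUP F\<in>?S. ?h F)"
      proof (rule field_le_epsilon)
        fix e :: real assume e: "0 < e"
        \<comment> \<open>The error is shared among the rounds; \<open>real T + 1\<close> keeps the
          denominator positive for \<open>T = 0\<close>.\<close>
        define d where "d = e / (real T + 1)"
        have d: "0 < d" "real T * d \<le> e"
          using e by (auto simp: d_def field_simps)
        have "\<forall>t\<in>{..<T}. \<exists>f. f \<in> selectors \<and> gain (\<gamma> t) (b t) \<le> gain (\<gamma> t) (f (\<gamma> t)) \<and>
            val (\<gamma> t) * alloc (\<gamma> t) (b t) \<le> val (\<gamma> t) * alloc (\<gamma> t) (f (\<gamma> t)) + d"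
        proof
          fix t assume "t \<in> {..<T}"
          then show "\<exists>f. f \<in> selectors \<and> gain (\<gamma> t) (b t) \<le> gain (\<gamma> t) (f (\<gamma> t)) \<and>
            val (\<gamma> t) * alloc (\<gamma> t) (b t) \<le> val (\<gamma> t) * alloc (\<gamma> t) (f (\<gamma> t)) + d"
            using selectors_approximate[of "\<gamma> t" "b t" d] \<gamma> b d unfolding Bex_def by simp
        qed
        from bchoice[OF this] obtain G where G: "\<forall>t\<in>{..<T}. G t \<in> selectors \<and>
            gain (\<gamma> t) (b t) \<le> gain (\<gamma> t) (G t (\<gamma> t)) \<and>
            val (\<gamma> t) * alloc (\<gamma> t) (b t) \<le> val (\<gamma> t) * alloc (\<gamma> t) (G t (\<gamma> t)) + d"
          by blast
        define F where "F = restrict G {..<T}"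
        have F: "F \<in> ?S"
          using G by (auto simp: F_def)
        have "(\<Sum>t<T. gain (\<gamma> t) (b t)) \<le> (\<Sum>t<T. gain (\<gamma> t) (F t (\<gamma> t)))"
          using G by (intro sum_mono) (auto simp: F_def)
        then have RoS: "satisfies_RoS T \<gamma> (\<lambda>t. F t (\<gamma> t))"
          using b unfolding satisfies_RoS_iff_gain by linarith
        have "y \<le> (\<Sum>t<T. val (\<gamma> t) * alloc (\<gamma> t) (F t (\<gamma> t)) + d)"
          unfolding y reward_def using G by (intro sum_mono) (auto simp: F_def)
        also have "\<dots> = ?h F + real T * d"
          using RoS by (simp add: reward_def sum.distrib)
        also have "\<dots> \<le> (SUP F\<in>?S. ?h F) + e"
          using cSUP_upper[OF F bdd] d by linarith
        finally show "y \<le> (SUP F\<in>?S. ?h F) + e" .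
      qed
    qed
    show "(SUP F\<in>?S. ?h F) \<le> opt_reward T \<gamma>"
      using upper by (intro cSUP_least[OF ne]) auto
  qed
qed

section \<open>Measurability under i.i.d. requests\<close>

locale iid_requests =
  fixes P :: "request measure"
  assumes request_distribution: "request_distribution P"
begin

sublocale prob_space P
  using request_distribution by (simp add: request_distribution_def)

sublocale product: product_prob_space "\<lambda>_::nat. P" UNIV ..

abbreviation Q :: "nat \<Rightarrow> (nat \<Rightarrow> request) measure" where
  "Q T \<equiv> \<Pi>\<^sub>M t\<in>{..<T}. P"

lemma truthful: "r \<in> space P \<Longrightarrow> truthful_request r"
  using request_distribution unfolding request_distribution_def by blast

lemma space_Q: "\<gamma> \<in> space (Q T) \<Longrightarrow> t < T \<Longrightarrow> \<gamma> t \<in> space P"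
  by (auto simp: space_PiM PiE_iff)

lemma truthful_Q: "\<gamma> \<in> space (Q T) \<Longrightarrow> \<forall>t<T. truthful_request (\<gamma> t)"
  using space_Q truthful by blast

lemma measurable_val [measurable]: "val \<in> borel_measurable P"
  using request_distribution unfolding request_distribution_def by blast

text \<open>The bid may be random, so joint measurability is used; it is given over nonnegative bids
  only, whence the condition on \<open>b\<close>.\<close>

lemma measurable_alloc:
  assumes [measurable]: "f \<in> measurable M P" "b \<in> borel_measurable M"
    and b: "\<And>w. w \<in> space M \<Longrightarrow> 0 \<le> b w"
  shows "(\<lambda>w. alloc (f w) (b w)) \<in> borel_measurable M"
proof -
  have "(\<lambda>w. (f w, b w)) \<in> M \<rightarrow>\<^sub>M P \<Otimes>\<^sub>M restrict_space borel {0..}"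
    using b by (intro measurable_Pair measurable_restrict_space2) auto
  from measurable_compose[OF this, of "\<lambda>(r, b). alloc r b"] show ?thesis
    using request_distribution unfolding request_distribution_def by simp
qed

lemma measurable_pay:
  assumes [measurable]: "f \<in> measurable M P" "b \<in> borel_measurable M"
    and b: "\<And>w. w \<in> space M \<Longrightarrow> 0 \<le> b w"
  shows "(\<lambda>w. pay (f w) (b w)) \<in> borel_measurable M"
proof -
  have "(\<lambda>w. (f w, b w)) \<in> M \<rightarrow>\<^sub>M P \<Otimes>\<^sub>M restrict_space borel {0..}"
    using b by (intro measurable_Pair measurable_restrict_space2) auto
  from measurable_compose[OF this, of "\<lambda>(r, b). pay r b"] show ?thesis
    using request_distribution unfolding request_distribution_def by simp
qed

lemma measurable_value:
  assumes [measurable]: "f \<in> measurable M P" "b \<in> borel_measurable M"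
    and b: "\<And>w. w \<in> space M \<Longrightarrow> 0 \<le> b w"
  shows "(\<lambda>w. val (f w) * alloc (f w) (b w)) \<in> borel_measurable M"
  using measurable_alloc[OF assms] by measurable

lemma measurable_gain:
  assumes [measurable]: "f \<in> measurable M P" "b \<in> borel_measurable M"
    and b: "\<And>w. w \<in> space M \<Longrightarrow> 0 \<le> b w"
  shows "(\<lambda>w. gain (f w) (b w)) \<in> borel_measurable M"
  unfolding gain_def using measurable_value[OF assms] measurable_pay[OF assms] by measurable

lemma measurable_component: "t < T \<Longrightarrow> (\<lambda>\<gamma>. \<gamma> t) \<in> measurable (Q T) P"
  by measurable

lemma measurable_reward:
  assumes "\<And>t. t < T \<Longrightarrow> (\<lambda>\<gamma>. b \<gamma> t) \<in> borel_measurable (Q T)"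
    and "\<And>\<gamma> t. \<gamma> \<in> space (Q T) \<Longrightarrow> t < T \<Longrightarrow> 0 \<le> b \<gamma> t"
  shows "(\<lambda>\<gamma>. reward T \<gamma> (b \<gamma>)) \<in> borel_measurable (Q T)"
  unfolding reward_def
  by (intro borel_measurable_sum measurable_value measurable_component) (use assms in auto)

lemma measurable_threshold_bid: "threshold_bid q s \<in> borel_measurable P"
  unfolding threshold_bid_def
proof (rule borel_measurable_cINF_real)
  show "countable (\<rat> \<inter> {0::real..})"
    by (simp add: countable_Int1 countable_rat)
  fix z :: real assume "z \<in> \<rat> \<inter> {0..}"
  then have [measurable]: "(\<lambda>r. alloc r z) \<in> borel_measurable P"
    by (intro measurable_alloc) auto
  show "(\<lambda>r. if q \<le> alloc r z then z else s) \<in> borel_measurable P"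
    by measurable
qed

lemma measurable_selectors: "f \<in> selectors \<Longrightarrow> f \<in> borel_measurable P"
  unfolding selectors_def using measurable_val measurable_threshold_bid by auto

lemma measurable_opt_reward: "opt_reward T \<in> borel_measurable (Q T)"
proof -
  let ?h = "\<lambda>F \<gamma>. if satisfies_RoS T \<gamma> (\<lambda>t. F t (\<gamma> t)) then reward T \<gamma> (\<lambda>t. F t (\<gamma> t)) else 0"
  have "(\<lambda>\<gamma>. SUP F\<in>{..<T} \<rightarrow>\<^sub>E selectors. ?h F \<gamma>) \<in> borel_measurable (Q T)"
  proof (rule borel_measurable_cSUP)
    show "countable ({..<T} \<rightarrow>\<^sub>E selectors)"
      by (intro countable_PiE countable_selectors) simp
    show "bdd_above ((\<lambda>F. ?h F \<gamma>) ` ({..<T} \<rightarrow>\<^sub>E selectors))" if "\<gamma> \<in> space (Q T)" for \<gamma>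
      by (rule opt_reward_eq_SUP_selectors(2)[OF truthful_Q[OF that]])
    fix F assume F: "F \<in> {..<T} \<rightarrow>\<^sub>E selectors"
    have F_sel: "F t \<in> selectors" if "t < T" for t
      using F that by (auto simp: PiE_iff)
    have bid: "(\<lambda>\<gamma>. F t (\<gamma> t)) \<in> borel_measurable (Q T)" if "t < T" for t
      using measurable_compose[OF measurable_component measurable_selectors] F_sel that by blast
    have nonneg: "0 \<le> F t (\<gamma> t)" if "t < T" "\<gamma> \<in> space (Q T)" for t \<gamma>
      using that F_sel truthful_Q selectors_nonneg by blast
    have [measurable]: "(\<lambda>\<gamma>. reward T \<gamma> (\<lambda>t. F t (\<gamma> t))) \<in> borel_measurable (Q T)"
      by (rule measurable_reward) (use bid nonneg in auto)
    have [measurable]: "(\<lambda>\<gamma>. \<Sum>t<T. gain (\<gamma> t) (F t (\<gamma> t))) \<in> borel_measurable (Q T)"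
      by (intro borel_measurable_sum measurable_gain measurable_component) (use bid nonneg in auto)
    show "?h F \<in> borel_measurable (Q T)"
      unfolding satisfies_RoS_iff_gain by measurable
  qed
  also have "?this \<longleftrightarrow> opt_reward T \<in> borel_measurable (Q T)"
    by (intro measurable_cong opt_reward_eq_SUP_selectors(1)[symmetric] truthful_Q)
  finally show ?thesis .
qed

end

section \<open>Pathwise analysis of Algorithm R2\<close>

text \<open>Truncated subtraction makes this the initial multiplier 1 during the first phase, so it
  is positive in every round.\<close>

definition second_phase_multiplier :: "nat \<Rightarrow> (nat \<Rightarrow> request) \<Rightarrow> nat \<Rightarrow> real" where
  "second_phase_multiplier T \<gamma> t =
     (let K = first_phase_length T \<gamma> in multiplier_R (T - K) (\<lambda>i. \<gamma> (K + i)) (t - K))"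

abbreviation threshold :: "nat \<Rightarrow> real" where
  "threshold T \<equiv> 2 * sqrt (real T) * ln (real T)"

lemma second_phase_multiplier_pos: "0 < second_phase_multiplier T \<gamma> t"
  by (simp add: second_phase_multiplier_def Let_def multiplier_R_pos)

lemma first_phase_length_le: "first_phase_length T \<gamma> \<le> T"
  unfolding first_phase_length_def by (rule Least_le) simp

lemma first_phase_length_exit:
  "\<not> (first_phase_length T \<gamma> < T \<and>
     (\<Sum>i<first_phase_length T \<gamma>. gain (\<gamma> i) (val (\<gamma> i))) \<le> threshold T)"
  unfolding first_phase_length_def by (rule LeastI[of _ T]) simp

text \<open>Stopping-time form: membership of round \<open>t\<close> in the first phase is decided
  by the requests before \<open>t\<close>.\<close>

lemma less_first_phase_length_iff:
  "t < first_phase_length T \<gamma> \<longleftrightarrow>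
     t < T \<and> (\<forall>k\<le>t. (\<Sum>i<k. gain (\<gamma> i) (val (\<gamma> i))) \<le> threshold T)"
proof
  assume t: "t < first_phase_length T \<gamma>"
  have "k < T \<and> (\<Sum>i<k. gain (\<gamma> i) (val (\<gamma> i))) \<le> threshold T" if "k \<le> t" for k
    using not_less_Least[of k, OF order.strict_trans1[OF that t[unfolded first_phase_length_def]]]
    by blast
  then show "t < T \<and> (\<forall>k\<le>t. (\<Sum>i<k. gain (\<gamma> i) (val (\<gamma> i))) \<le> threshold T)"
    by blast
next
  assume "t < T \<and> (\<forall>k\<le>t. (\<Sum>i<k. gain (\<gamma> i) (val (\<gamma> i))) \<le> threshold T)"
  then show "t < first_phase_length T \<gamma>"
    using first_phase_length_exit[of T \<gamma>] by (meson not_le order_le_less_trans)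
qed

lemma less_first_phase_length_cong:
  assumes "\<And>i. i < t \<Longrightarrow> \<gamma> i = \<gamma>' i"
  shows "t < first_phase_length T \<gamma> \<longleftrightarrow> t < first_phase_length T \<gamma>'"
proof -
  have "(\<Sum>i<k. gain (\<gamma> i) (val (\<gamma> i))) = (\<Sum>i<k. gain (\<gamma>' i) (val (\<gamma>' i)))" if "k \<le> t" for k
    using assms that by (intro sum.cong) auto
  then show ?thesis
    unfolding less_first_phase_length_iff by auto
qed

text \<open>Once the first phase has ended by time \<open>t\<close>, the earlier requests determine
  both its length and the subsequent multiplier. This allows the request of round \<open>t\<close>
  to be averaged with the multiplier held fixed.\<close>

lemma second_phase_multiplier_cong:
  assumes eq: "\<And>i. i < t \<Longrightarrow> \<gamma> i = \<gamma>' i" and "first_phase_length T \<gamma> \<le> t"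
  shows "second_phase_multiplier T \<gamma> t = second_phase_multiplier T \<gamma>' t"
proof -
  have less_iff: "s < first_phase_length T \<gamma> \<longleftrightarrow> s < first_phase_length T \<gamma>'" if "s \<le> t" for s
    using eq that by (intro less_first_phase_length_cong) auto
  \<comment> \<open>The equivalence at the first length bounds the second length by it, hence by
    \<open>t\<close>; the equivalence at the second length then gives the reverse
    inequality.\<close>
  have K: "first_phase_length T \<gamma>' = first_phase_length T \<gamma>"
    using less_iff[of "first_phase_length T \<gamma>"] less_iff[of "first_phase_length T \<gamma>'"] assms(2)
    by auto
  show ?thesis
    unfolding second_phase_multiplier_def K Let_def using eq by (intro multiplier_R_cong) auto
qed

lemma bid_R2_eq:
  "bid_R2 T \<gamma> t =
     (if t < first_phase_length T \<gamma> then val (\<gamma> t)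
      else shaded_bid (second_phase_multiplier T \<gamma> t) (\<gamma> t))"
  by (simp add: bid_R2_def second_phase_multiplier_def bid_R_eq_shaded_bid Let_def)

lemma bid_R2_first:
  "t < first_phase_length T \<gamma> \<Longrightarrow> bid_R2 T \<gamma> t = val (\<gamma> t)"
  by (simp add: bid_R2_eq)

lemma bid_R2_second:
  fixes T \<gamma>
  defines "K \<equiv> first_phase_length T \<gamma>"
  shows "bid_R2 T \<gamma> (K + i) = bid_R (T - K) (\<lambda>i. \<gamma> (K + i)) i"
  by (simp add: bid_R2_def K_def Let_def)

lemma bid_R2_nonneg: "truthful_request (\<gamma> t) \<Longrightarrow> 0 \<le> bid_R2 T \<gamma> t"
  by (simp add: bid_R2_eq truthful_val shaded_bid_nonneg second_phase_multiplier_pos)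

text \<open>A crude bound that serves integrability; the regret estimate controls the products of
  multiplier and gain instead.\<close>

lemma second_phase_multiplier_bound:
  assumes "\<forall>t<T. truthful_request (\<gamma> t)" "t < T"
  shows "second_phase_multiplier T \<gamma> t \<le> 1 + 2 * sqrt (real T)"
proof -
  define K where "K = first_phase_length T \<gamma>"
  have "second_phase_multiplier T \<gamma> t \<le> 1 + 2 * (real (t - K) / sqrt (real (T - K)))"
    unfolding second_phase_multiplier_def Let_def K_def[symmetric]
    using assms by (intro multiplier_R_linear_growth) auto
  also have "real (t - K) / sqrt (real (T - K)) \<le> real (T - K) / sqrt (real (T - K))"
    using assms by (intro divide_right_mono) auto
  also have "\<dots> \<le> sqrt (real T)"
    by (simp add: real_div_sqrt)
  finally show ?thesis
    by simp
qed

lemma sum_lessThan_split: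
  fixes f :: "nat \<Rightarrow> real"
  assumes "K \<le> T"
  shows "(\<Sum>t<T. f t) = (\<Sum>t<K. f t) + (\<Sum>i<T - K. f (K + i))"
proof -
  have "(\<Sum>t<K + n. f t) = (\<Sum>t<K. f t) + (\<Sum>i<n. f (K + i))" for n
    by (induction n) auto
  from this[of "T - K"] show ?thesis
    using assms by simp
qed

lemma threshold_covers_violation:
  assumes T: "2 \<le> T" and n: "n \<le> T"
  shows "sqrt (real n) * ln (1 + 2 * sqrt (real n)) \<le> threshold T"
proof -
  \<comment> \<open>This gives \<open>2 * sqrt T <= T + 1\<close>. Together with
    \<open>T + 2 <= T\<^sup>2\<close> for \<open>T >= 2\<close> the logarithm is at most
    \<open>2 * ln T\<close>, which matches the factor 2 in the threshold.\<close>
  have "0 \<le> (sqrt (real T) - 1)\<^sup>2"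
    by simp
  then have "1 + 2 * sqrt (real T) \<le> real T + 2"
    by (simp add: power2_eq_square algebra_simps)
  also have "\<dots> \<le> (real T)\<^sup>2"
    using mult_right_mono[of 2 "real T" "real T"] T unfolding power2_eq_square by linarith
  finally have "1 + 2 * sqrt (real n) \<le> (real T)\<^sup>2"
    using n real_sqrt_le_mono[of "real n" "real T"] by linarith
  then have "ln (1 + 2 * sqrt (real n)) \<le> ln ((real T)\<^sup>2)"
    by (subst ln_le_cancel_iff) (use T in \<open>auto simp: add_pos_nonneg\<close>)
  also have "\<dots> = 2 * ln (real T)"
    using T by (simp add: ln_realpow)
  finally have "sqrt (real n) * ln (1 + 2 * sqrt (real n)) \<le> sqrt (real T) * (2 * ln (real T))"
    using n by (intro mult_mono) (auto intro!: ln_ge_zero)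
  then show ?thesis
    by (simp add: mult_ac)
qed

text \<open>Either the first phase ends early with gain above the threshold, which pays for any
  violation in the second phase, or it fills the horizon and every gain is nonnegative.\<close>

lemma satisfies_RoS_bid_R2:
  assumes \<gamma>: "\<forall>t<T. truthful_request (\<gamma> t)" and T: "2 \<le> T"
  shows "satisfies_RoS T \<gamma> (bid_R2 T \<gamma>)"
proof -
  define K where "K = first_phase_length T \<gamma>"
  have K: "K \<le> T"
    by (simp add: K_def first_phase_length_le)
  have split: "(\<Sum>t<T. gain (\<gamma> t) (bid_R2 T \<gamma> t)) =
      (\<Sum>t<K. gain (\<gamma> t) (val (\<gamma> t))) +
      (\<Sum>i<T - K. gain (\<gamma> (K + i)) (bid_R (T - K) (\<lambda>i. \<gamma> (K + i)) i))"
    unfolding sum_lessThan_split[OF K] by (simp add: K_def bid_R2_first bid_R2_second)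
  show ?thesis
  proof (cases "K < T")
    case True
    have "threshold T < (\<Sum>t<K. gain (\<gamma> t) (val (\<gamma> t)))"
      using first_phase_length_exit[of T \<gamma>] True by (simp add: K_def)
    moreover have "- (sqrt (real (T - K)) * ln (1 + 2 * sqrt (real (T - K))))
        \<le> (\<Sum>i<T - K. gain (\<gamma> (K + i)) (bid_R (T - K) (\<lambda>i. \<gamma> (K + i)) i))"
      using sum_gain_R_lower[of "T - K" "\<lambda>i. \<gamma> (K + i)"] \<gamma> True by simp
    ultimately show ?thesis
      using threshold_covers_violation[OF T, of "T - K"]
      unfolding satisfies_RoS_iff_gain split by linarith
  next
    case False
    then have "K = T"
      using K by simp
    then show ?thesis
      unfolding satisfies_RoS_iff_gain split
      by (simp, intro sum_nonneg) (use \<gamma> truthful_gain_val in simp)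
  qed
qed

text \<open>The nonnegative value of the first phase is discarded. In the second phase the reward is
  the sum of Lagrangians minus the sum of multiplier times gain, and the latter is at most
  \<open>6 * sqrt n\<close> for the remaining horizon \<open>n\<close>.\<close>

lemma reward_bid_R2_lower:
  assumes \<gamma>: "\<forall>t<T. truthful_request (\<gamma> t)"
  shows "(\<Sum>t<T. if t < first_phase_length T \<gamma> then 0
            else lagrangian (second_phase_multiplier T \<gamma> t) (\<gamma> t)) - 6 * sqrt (real T)
         \<le> reward T \<gamma> (bid_R2 T \<gamma>)"
proof -
  define K where "K = first_phase_length T \<gamma>"
  have K: "K \<le> T"
    by (simp add: K_def first_phase_length_le)
  let ?\<delta> = "\<lambda>i. \<gamma> (K + i)" and ?n = "T - K"
  let ?l = "multiplier_R ?n ?\<delta>"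
  have "(\<Sum>t<T. if t < K then 0 else lagrangian (second_phase_multiplier T \<gamma> t) (\<gamma> t)) =
      (\<Sum>i<?n. lagrangian (?l i) (?\<delta> i))"
    unfolding sum_lessThan_split[OF K] by (simp add: second_phase_multiplier_def Let_def K_def)
  also have "\<dots> = (\<Sum>i<?n. val (?\<delta> i) * alloc (?\<delta> i) (bid_R ?n ?\<delta> i)) +
      (\<Sum>i<?n. ?l i * gain (?\<delta> i) (bid_R ?n ?\<delta> i))"
    by (simp add: lagrangian_def bid_R_eq_shaded_bid sum.distrib)
  also have "(\<Sum>i<?n. ?l i * gain (?\<delta> i) (bid_R ?n ?\<delta> i)) \<le> 6 * sqrt (real ?n)"
    using \<gamma> by (intro sum_multiplier_gain_R_upper) auto
  also have "\<dots> \<le> 6 * sqrt (real T)"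
    by simp
  also have "(\<Sum>i<?n. val (?\<delta> i) * alloc (?\<delta> i) (bid_R ?n ?\<delta> i)) \<le>
      (\<Sum>t<K. val (\<gamma> t) * alloc (\<gamma> t) (val (\<gamma> t))) +
      (\<Sum>i<?n. val (?\<delta> i) * alloc (?\<delta> i) (bid_R ?n ?\<delta> i))"
  proof -
    have "0 \<le> (\<Sum>t<K. val (\<gamma> t) * alloc (\<gamma> t) (val (\<gamma> t)))"
    proof (rule sum_nonneg)
      fix t assume "t \<in> {..<K}"
      then show "0 \<le> val (\<gamma> t) * alloc (\<gamma> t) (val (\<gamma> t))"
        using \<gamma> K truthful_val[of "\<gamma> t"] truthful_value[of "\<gamma> t" "val (\<gamma> t)"] by auto
    qed
    then show ?thesis
      by simp
  qed
  also have "\<dots> = reward T \<gamma> (bid_R2 T \<gamma>)"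
    unfolding reward_def sum_lessThan_split[OF K] by (simp add: K_def bid_R2_first bid_R2_second)
  finally show ?thesis
    by (simp add: K_def)
qed

text \<open>Before the last round of the first phase the gain is still within the threshold, and
  that round overshoots by at most 1.\<close>

lemma first_phase_gain_upper:
  assumes \<gamma>: "\<forall>t<T. truthful_request (\<gamma> t)" and T: "1 \<le> T"
  shows "(\<Sum>t<T. if t < first_phase_length T \<gamma> then gain (\<gamma> t) (val (\<gamma> t)) else 0)
         \<le> threshold T + 1"
proof -
  define K where "K = first_phase_length T \<gamma>"
  have K: "K \<le> T"
    by (simp add: K_def first_phase_length_le)
  have "(\<Sum>t<T. if t < K then gain (\<gamma> t) (val (\<gamma> t)) else 0) = (\<Sum>t<K. gain (\<gamma> t) (val (\<gamma> t)))"
    unfolding sum_lessThan_split[OF K] by simp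
  also have "\<dots> \<le> threshold T + 1"
  proof (cases K)
    case 0
    then show ?thesis
      using T by (simp add: add_nonneg_nonneg ln_ge_zero)
  next
    case (Suc k)
    then have "k < first_phase_length T \<gamma>"
      by (simp add: K_def)
    then have "(\<Sum>t<k. gain (\<gamma> t) (val (\<gamma> t))) \<le> threshold T"
      unfolding less_first_phase_length_iff by blast
    moreover have "truthful_request (\<gamma> k)"
      using \<gamma> K Suc by simp
    then have "gain (\<gamma> k) (val (\<gamma> k)) \<le> 1"
      using truthful_gain truthful_val by blast
    ultimately show ?thesis
      using Suc by simp
  qed
  finally show ?thesis
    by (simp add: K_def)
qed

section \<open>Expected regret\<close>

context iid_requests
begin

section \<open>Measurability of the algorithm and integrability of its regret\<close>

lemma measurable_first_phase_length [measurable]: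
  "first_phase_length T \<in> measurable (Q T) (count_space UNIV)"
  unfolding first_phase_length_def
proof (rule measurable_Least)
  fix k
  show "Measurable.pred (Q T) (\<lambda>\<gamma>. \<not> (k < T \<and> (\<Sum>i<k. gain (\<gamma> i) (val (\<gamma> i))) \<le> threshold T))"
  proof (cases "k < T")
    case True
    have [measurable]: "(\<lambda>\<gamma>. \<Sum>i<k. gain (\<gamma> i) (val (\<gamma> i))) \<in> borel_measurable (Q T)"
    proof (intro borel_measurable_sum measurable_gain measurable_component)
      fix i assume i: "i \<in> {..<k}"
      then show "i < T"
        using True by simp
      then show "(\<lambda>\<gamma>. val (\<gamma> i)) \<in> borel_measurable (Q T)"
        by (intro measurable_compose[OF measurable_component measurable_val])
      show "0 \<le> val (\<gamma> i)" if "\<gamma> \<in> space (Q T)" for \<gamma>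
        using truthful_Q[OF that] \<open>i < T\<close> by (simp add: truthful_val)
    qed
    show ?thesis
      by measurable
  next
    \<comment> \<open>The least element ranges over all naturals. From \<open>k = T\<close> on the
      guard fails outright, so coordinates outside the product never matter.\<close>
    case False
    then have "(\<lambda>\<gamma>. \<not> (k < T \<and> (\<Sum>i<k. gain (\<gamma> i) (val (\<gamma> i))) \<le> threshold T)) = (\<lambda>_. True)"
      by simp
    then show ?thesis
      by (simp only: measurable_const UNIV_I space_count_space)
  qed
qed

lemma measurable_shaded_bid:
  assumes [measurable]: "f \<in> measurable M P" "l \<in> borel_measurable M"
  shows "(\<lambda>w. shaded_bid (l w) (f w)) \<in> borel_measurable M"
  unfolding shaded_bid_def by measurable

lemma measurable_lagrangian:
  assumes [measurable]: "f \<in> measurable M P" "l \<in> borel_measurable M"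
    and l: "\<And>w. w \<in> space M \<Longrightarrow> 0 < l w"
  shows "(\<lambda>w. lagrangian (l w) (f w)) \<in> borel_measurable M"
proof -
  note [measurable] = measurable_shaded_bid[OF assms(1,2)]
  have nonneg: "0 \<le> shaded_bid (l w) (f w)" if "w \<in> space M" for w
    using that l measurable_space[OF assms(1)] truthful by (intro shaded_bid_nonneg) auto
  have [measurable]: "(\<lambda>w. val (f w) * alloc (f w) (shaded_bid (l w) (f w))) \<in> borel_measurable M"
    "(\<lambda>w. gain (f w) (shaded_bid (l w) (f w))) \<in> borel_measurable M"
    using nonneg by (auto intro!: measurable_value measurable_gain)
  show ?thesis
    unfolding lagrangian_def by measurable
qed

lemma measurable_multiplier_R:
  assumes "\<And>i. i < s \<Longrightarrow> k + i < T"
  shows "(\<lambda>\<gamma>. multiplier_R n (\<lambda>i. \<gamma> (k + i)) s) \<in> borel_measurable (Q T)"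
  using assms
proof (induction s)
  case (Suc s)
  then have [measurable]: "(\<lambda>\<gamma>. multiplier_R n (\<lambda>i. \<gamma> (k + i)) s) \<in> borel_measurable (Q T)"
    by simp
  have ks: "k + s < T"
    using Suc.prems by simp
  note [measurable] = measurable_shaded_bid[OF measurable_component[OF ks] Suc.IH[OF Suc.prems], simplified]
  have [measurable]: "(\<lambda>\<gamma>. gain (\<gamma> (k + s)) (shaded_bid (multiplier_R n (\<lambda>i. \<gamma> (k + i)) s) (\<gamma> (k + s))))
      \<in> borel_measurable (Q T)"
    using truthful_Q ks
    by (intro measurable_gain measurable_component measurable_shaded_bid shaded_bid_nonneg
        multiplier_R_pos) auto
  show ?case
    unfolding multiplier_R_Suc bid_R_eq_shaded_bid by measurable
qed simp

text \<open>The random shift takes countably many values. For each fixed shift the multiplier reads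
  only requests before round \<open>t\<close>.\<close>

lemma measurable_second_phase_multiplier [measurable]:
  assumes t: "t < T"
  shows "(\<lambda>\<gamma>. second_phase_multiplier T \<gamma> t) \<in> borel_measurable (Q T)"
  unfolding second_phase_multiplier_def Let_def
  by (rule measurable_compose_countable[OF measurable_multiplier_R measurable_first_phase_length])
    (use t in simp)

lemma measurable_bid_R2:
  assumes t: "t < T"
  shows "(\<lambda>\<gamma>. bid_R2 T \<gamma> t) \<in> borel_measurable (Q T)"
proof -
  note [measurable] = measurable_component[OF t] measurable_second_phase_multiplier[OF t]
    measurable_shaded_bid[OF measurable_component[OF t] measurable_second_phase_multiplier[OF t]]
  have [measurable]: "Measurable.pred (Q T) (\<lambda>\<gamma>. t < first_phase_length T \<gamma>)"
    by measurable
  show ?thesis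
    unfolding bid_R2_eq by measurable
qed

lemma prob_space_Q: "prob_space (Q T)"
  by (rule prob_space_PiM) unfold_locales

lemma integrable_bounded_Q:
  fixes f :: "(nat \<Rightarrow> request) \<Rightarrow> real"
  assumes "f \<in> borel_measurable (Q T)" "\<And>\<gamma>. \<gamma> \<in> space (Q T) \<Longrightarrow> \<bar>f \<gamma>\<bar> \<le> B"
  shows "integrable (Q T) f"
proof -
  interpret Q: prob_space "Q T"
    by (rule prob_space_Q)
  show ?thesis
    using assms by (intro Q.integrable_const_bound[of _ B] AE_I2) simp_all
qed

lemma integrable_sample_regret: "integrable (Q T) (sample_regret T (bid_R2 T))"
proof (rule integrable_bounded_Q)
  have [measurable]: "(\<lambda>\<gamma>. reward T \<gamma> (bid_R2 T \<gamma>)) \<in> borel_measurable (Q T)"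
    by (intro measurable_reward measurable_bid_R2 bid_R2_nonneg) (simp_all add: truthful_Q)
  note [measurable] = measurable_opt_reward
  show "sample_regret T (bid_R2 T) \<in> borel_measurable (Q T)"
    unfolding sample_regret_def by measurable
  fix \<gamma> assume "\<gamma> \<in> space (Q T)"
  note \<gamma> = truthful_Q[OF this]
  then have "\<forall>t<T. 0 \<le> bid_R2 T \<gamma> t"
    using bid_R2_nonneg by simp
  then have "0 \<le> opt_reward T \<gamma> \<and> opt_reward T \<gamma> \<le> real T"
    "0 \<le> reward T \<gamma> (bid_R2 T \<gamma>) \<and> reward T \<gamma> (bid_R2 T \<gamma>) \<le> real T"
    using opt_reward_bounds[OF \<gamma>] reward_bounds[OF \<gamma>] by simp_all
  then show "\<bar>sample_regret T (bid_R2 T) \<gamma>\<bar> \<le> real T"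
    unfolding sample_regret_def by linarith
qed

text \<open>The request of round \<open>t\<close> is independent of the other rounds, so it may be averaged first.\<close>

lemma integral_nonneg_by_fresh_request:
  fixes H :: "(nat \<Rightarrow> request) \<Rightarrow> real"
  assumes t: "t < T" and H: "integrable (Q T) H"
    and inner: "\<And>\<gamma>. 0 \<le> (LINT r|P. H (\<gamma>(t := r)))"
  shows "0 \<le> (LINT \<gamma>|Q T. H \<gamma>)"
proof -
  have ins: "insert t ({..<T} - {t}) = {..<T}"
    using t by auto
  have "(LINT \<gamma>|Q T. H \<gamma>) = (LINT \<gamma>|(\<Pi>\<^sub>M i\<in>{..<T} - {t}. P). LINT r|P. H (\<gamma>(t := r)))"
    using product.product_integral_insert[of "{..<T} - {t}" t H, unfolded ins] H by simp
  also have "\<dots> \<ge> 0"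
    using inner by (rule Bochner_Integration.integral_nonneg)
  finally show ?thesis .
qed

section \<open>The expected Lagrangian dual\<close>

definition dual :: "real \<Rightarrow> real" where
  "dual l = (LINT r|P. lagrangian l r)"

text \<open>The benchmark per round. The infimum need not be attained, so the regret is first
  bounded for every \<open>l\<close> and only then is the infimum taken.\<close>

definition dual_value :: real where
  "dual_value = (INF l\<in>{0<..}. dual l)"

lemma integrable_lagrangian:
  assumes "0 < l"
  shows "integrable P (lagrangian l)"
proof (rule integrable_const_bound[of _ "1 + l"])
  show "lagrangian l \<in> borel_measurable P"
    using measurable_lagrangian[of "\<lambda>r. r" P "\<lambda>_. l"] assms by simp
  show "AE r in P. norm (lagrangian l r) \<le> 1 + l"
  proof (rule AE_I2)
    fix r assume "r \<in> space P"
    then show "norm (lagrangian l r) \<le> 1 + l"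
      using lagrangian_bounds[OF truthful assms, of r] by simp
  qed
qed

lemma dual_bounds:
  assumes "0 < l"
  shows "0 \<le> dual l" "dual l \<le> 1 + l"
proof -
  show "0 \<le> dual l"
    unfolding dual_def by (intro integral_nonneg_AE AE_I2) (simp add: lagrangian_bounds truthful assms)
  have "dual l \<le> (LINT r|P. 1 + l)"
    unfolding dual_def
    by (intro integral_mono integrable_lagrangian) (simp_all add: lagrangian_bounds truthful assms)
  then show "dual l \<le> 1 + l"
    by (simp add: prob_space)
qed

lemma dual_value_le: "0 < l \<Longrightarrow> dual_value \<le> dual l"
  unfolding dual_value_def using dual_bounds by (intro cINF_lower bdd_belowI2[of _ 0]) auto

lemma integral_lagrangian_component:
  assumes t: "t < T" and l: "0 < l"
  shows "integrable (Q T) (\<lambda>\<gamma>. lagrangian l (\<gamma> t))" (is ?int)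
    and "(LINT \<gamma>|Q T. lagrangian l (\<gamma> t)) \<le> dual l"
proof -
  interpret Q: prob_space "Q T"
    by (rule prob_space_Q)
  show int: ?int
  proof (rule integrable_bounded_Q)
    show "(\<lambda>\<gamma>. lagrangian l (\<gamma> t)) \<in> borel_measurable (Q T)"
      by (intro measurable_lagrangian measurable_component t) (use l in auto)
    show "\<bar>lagrangian l (\<gamma> t)\<bar> \<le> 1 + l" if "\<gamma> \<in> space (Q T)" for \<gamma>
      using lagrangian_bounds[OF truthful l, OF space_Q[OF that t]] by simp
  qed
  have "0 \<le> (LINT \<gamma>|Q T. dual l - lagrangian l (\<gamma> t))"
    using int l integrable_lagrangian[OF l]
    by (intro integral_nonneg_by_fresh_request[OF t]) (simp_all add: dual_def prob_space)
  then show "(LINT \<gamma>|Q T. lagrangian l (\<gamma> t)) \<le> dual l"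
    using int by (simp add: Q.prob_space)
qed

section \<open>Expected length of the first phase and reward of the second\<close>

definition exploring :: "nat \<Rightarrow> nat \<Rightarrow> (nat \<Rightarrow> request) \<Rightarrow> real" where
  "exploring T t \<gamma> = (if t < first_phase_length T \<gamma> then 1 else 0)"

lemma integrable_exploring: "integrable (Q T) (exploring T t)"
  unfolding exploring_def by (rule integrable_bounded_Q[of _ _ 1]) auto

lemma exploring_fresh: "exploring T t (\<gamma>(t := r)) = exploring T t \<gamma>"
  using less_first_phase_length_cong[of t "\<gamma>(t := r)" \<gamma> T] by (simp add: exploring_def)

lemma integrable_exploring_gain:
  assumes t: "t < T"
  shows "integrable (Q T) (\<lambda>\<gamma>. exploring T t \<gamma> * gain (\<gamma> t) (val (\<gamma> t)))"
proof (rule integrable_bounded_Q)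
  note [measurable] = measurable_compose[OF measurable_component[OF t] measurable_val]
    borel_measurable_integrable[OF integrable_exploring]
  have [measurable]: "(\<lambda>\<gamma>. gain (\<gamma> t) (val (\<gamma> t))) \<in> borel_measurable (Q T)"
    by (intro measurable_gain measurable_component t) (use t truthful_Q truthful_val in auto)
  show "(\<lambda>\<gamma>. exploring T t \<gamma> * gain (\<gamma> t) (val (\<gamma> t))) \<in> borel_measurable (Q T)"
    by measurable
  fix \<gamma> assume "\<gamma> \<in> space (Q T)"
  then have "truthful_request (\<gamma> t)"
    using t truthful_Q by blast
  then show "\<bar>exploring T t \<gamma> * gain (\<gamma> t) (val (\<gamma> t))\<bar> \<le> 1"
    using truthful_gain truthful_val by (auto simp: exploring_def abs_le_iff)
qed

lemma expected_slack_eq: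
  "expected_slack P = (LINT r|P. gain r (val r))"
  unfolding expected_slack_def
  by (intro Bochner_Integration.integral_cong)
    (use truthful truthful_gain_val in \<open>auto simp: gain_def simp del: split_paired_All\<close>)

lemma integrable_gain_val: "integrable P (\<lambda>r. gain r (val r))"
proof (rule integrable_const_bound[of _ 1])
  show "(\<lambda>r. gain r (val r)) \<in> borel_measurable P"
    by (intro measurable_gain measurable_val measurable_ident) (use truthful truthful_val in auto)
  show "AE r in P. norm (gain r (val r)) \<le> 1"
  proof (rule AE_I2)
    fix r assume "r \<in> space P"
    then show "norm (gain r (val r)) \<le> 1"
      using truthful_gain[of r "val r"] truthful_val[of r] truthful[of r] by (simp add: abs_le_iff)
  qed
qed

text \<open>The core of Wald's identity: the indicator is fixed before round \<open>t\<close>, so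
  averaging over that request replaces its gain by the expected slack.\<close>

lemma expected_exploring_gain:
  assumes t: "t < T"
  shows "expected_slack P * (LINT \<gamma>|Q T. exploring T t \<gamma>)
    \<le> (LINT \<gamma>|Q T. exploring T t \<gamma> * gain (\<gamma> t) (val (\<gamma> t)))"
proof -
  let ?H = "\<lambda>\<gamma>. exploring T t \<gamma> * gain (\<gamma> t) (val (\<gamma> t)) - expected_slack P * exploring T t \<gamma>"
  have "0 \<le> (LINT \<gamma>|Q T. ?H \<gamma>)"
  proof (rule integral_nonneg_by_fresh_request[OF t])
    show "integrable (Q T) ?H"
      using integrable_exploring integrable_exploring_gain[OF t] by simp
    show "0 \<le> (LINT r|P. ?H (\<gamma>(t := r)))" for \<gamma>
      using integrable_gain_val by (simp add: exploring_fresh expected_slack_eq prob_space)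
  qed
  then show ?thesis
    using integrable_exploring integrable_exploring_gain[OF t] by simp
qed

lemma expected_first_phase:
  assumes T: "1 \<le> T"
  shows "expected_slack P * (\<Sum>t<T. LINT \<gamma>|Q T. exploring T t \<gamma>) \<le> threshold T + 1"
proof -
  interpret Q: prob_space "Q T"
    by (rule prob_space_Q)
  have "expected_slack P * (\<Sum>t<T. LINT \<gamma>|Q T. exploring T t \<gamma>) \<le>
      (\<Sum>t<T. LINT \<gamma>|Q T. exploring T t \<gamma> * gain (\<gamma> t) (val (\<gamma> t)))"
    unfolding sum_distrib_left using expected_exploring_gain by (intro sum_mono) auto
  also have "\<dots> = (LINT \<gamma>|Q T. (\<Sum>t<T. exploring T t \<gamma> * gain (\<gamma> t) (val (\<gamma> t))))"
    using integrable_exploring_gain by (intro Bochner_Integration.integral_sum[symmetric]) auto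
  also have "\<dots> \<le> (LINT \<gamma>|Q T. threshold T + 1)"
  proof (intro integral_mono Bochner_Integration.integrable_sum integrable_exploring_gain)
    fix \<gamma> assume "\<gamma> \<in> space (Q T)"
    from first_phase_gain_upper[OF truthful_Q[OF this] T]
    show "(\<Sum>t<T. exploring T t \<gamma> * gain (\<gamma> t) (val (\<gamma> t))) \<le> threshold T + 1"
      by (simp add: exploring_def if_distrib[of "\<lambda>c. c * _"] cong: if_cong)
  qed auto
  also have "\<dots> = threshold T + 1"
    by (simp add: Q.prob_space)
  finally show ?thesis .
qed

text \<open>In a second-phase round, averaging over the fresh request gives \<open>dual\<close> at a
  fixed multiplier, which is at least \<open>dual_value\<close>; in a first-phase round both
  contributions vanish.\<close>

lemma expected_second_phase:
  assumes t: "t < T"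
  shows "integrable (Q T)
      (\<lambda>\<gamma>. (1 - exploring T t \<gamma>) * lagrangian (second_phase_multiplier T \<gamma> t) (\<gamma> t))" (is "integrable _ ?L")
    and "dual_value * (1 - (LINT \<gamma>|Q T. exploring T t \<gamma>)) \<le>
      (LINT \<gamma>|Q T. (1 - exploring T t \<gamma>) * lagrangian (second_phase_multiplier T \<gamma> t) (\<gamma> t))"
proof -
  interpret Q: prob_space "Q T"
    by (rule prob_space_Q)
  show int: "integrable (Q T) ?L"
  proof (rule integrable_bounded_Q)
    note [measurable] = borel_measurable_integrable[OF integrable_exploring]
    have [measurable]: "(\<lambda>\<gamma>. lagrangian (second_phase_multiplier T \<gamma> t) (\<gamma> t)) \<in> borel_measurable (Q T)"
      by (intro measurable_lagrangian measurable_component measurable_second_phase_multiplier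
          second_phase_multiplier_pos t)
    show "?L \<in> borel_measurable (Q T)"
      by measurable
    fix \<gamma> assume \<gamma>: "\<gamma> \<in> space (Q T)"
    let ?m = "second_phase_multiplier T \<gamma> t"
    have "truthful_request (\<gamma> t)"
      using \<gamma> t truthful_Q by blast
    from lagrangian_bounds[OF this second_phase_multiplier_pos, of T \<gamma> t]
    have "\<bar>lagrangian ?m (\<gamma> t)\<bar> \<le> 1 + (1 + 2 * sqrt (real T))"
      using second_phase_multiplier_bound[OF truthful_Q[OF \<gamma>] t] by simp
    then show "\<bar>?L \<gamma>\<bar> \<le> 1 + (1 + 2 * sqrt (real T))"
      by (simp add: exploring_def)
  qed
  let ?H = "\<lambda>\<gamma>. ?L \<gamma> - dual_value * (1 - exploring T t \<gamma>)"
  have "0 \<le> (LINT \<gamma>|Q T. ?H \<gamma>)"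
  proof (rule integral_nonneg_by_fresh_request[OF t])
    show "integrable (Q T) ?H"
      using integrable_exploring int by simp
    show "0 \<le> (LINT r|P. ?H (\<gamma>(t := r)))" for \<gamma>
    proof (cases "t < first_phase_length T \<gamma>")
      case True
      then show ?thesis
        unfolding exploring_fresh by (simp add: exploring_def)
    next
      case False
      have "second_phase_multiplier T (\<gamma>(t := r)) t = second_phase_multiplier T \<gamma> t" for r
        using False by (intro second_phase_multiplier_cong[symmetric]) auto
      then have "(LINT r|P. ?H (\<gamma>(t := r))) = dual (second_phase_multiplier T \<gamma> t) - dual_value"
        using False integrable_lagrangian[OF second_phase_multiplier_pos[of T \<gamma> t]]
        unfolding exploring_fresh by (simp add: exploring_def dual_def prob_space)
      then show ?thesis
        using dual_value_le[OF second_phase_multiplier_pos] by simp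
    qed
  qed
  then show "dual_value * (1 - (LINT \<gamma>|Q T. exploring T t \<gamma>)) \<le> (LINT \<gamma>|Q T. ?L \<gamma>)"
    using int integrable_exploring by (simp add: Q.prob_space)
qed

text \<open>The optimum is bounded by Lagrangians at one fixed \<open>l\<close>, the algorithm from
  below by those at its own multipliers, each at least \<open>dual_value\<close> on average.\<close>

lemma regret_le_dual:
  assumes l: "0 < l"
  shows "regret P T (bid_R2 T) \<le> real T * dual l
    - dual_value * (real T - (\<Sum>t<T. LINT \<gamma>|Q T. exploring T t \<gamma>)) + 6 * sqrt (real T)"
proof -
  interpret Q: prob_space "Q T"
    by (rule prob_space_Q)
  let ?L = "\<lambda>t \<gamma>. (1 - exploring T t \<gamma>) * lagrangian (second_phase_multiplier T \<gamma> t) (\<gamma> t)"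
  let ?U = "\<lambda>\<gamma>. (\<Sum>t<T. lagrangian l (\<gamma> t)) - (\<Sum>t<T. ?L t \<gamma>) + 6 * sqrt (real T)"
  have int: "integrable (Q T) (\<lambda>\<gamma>. \<Sum>t<T. lagrangian l (\<gamma> t))" "integrable (Q T) (\<lambda>\<gamma>. \<Sum>t<T. ?L t \<gamma>)"
    using integral_lagrangian_component(1)[OF _ l] expected_second_phase(1)
    by (auto intro!: Bochner_Integration.integrable_sum)
  have "regret P T (bid_R2 T) \<le> (LINT \<gamma>|Q T. ?U \<gamma>)"
    unfolding regret_def
  proof (rule integral_mono[OF integrable_sample_regret])
    show "integrable (Q T) ?U"
      using int by simp
    fix \<gamma> assume "\<gamma> \<in> space (Q T)"
    note \<gamma> = truthful_Q[OF this]
    have "(\<Sum>t<T. ?L t \<gamma>) - 6 * sqrt (real T) \<le> reward T \<gamma> (bid_R2 T \<gamma>)"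
      using reward_bid_R2_lower[OF \<gamma>]
      by (simp add: exploring_def if_distrib[of "\<lambda>c. (1 - c) * _"] cong: if_cong)
    then show "sample_regret T (bid_R2 T) \<gamma> \<le> ?U \<gamma>"
      unfolding sample_regret_def using opt_reward_le_lagrangian[OF \<gamma> l] by linarith
  qed
  also have "\<dots> = (\<Sum>t<T. LINT \<gamma>|Q T. lagrangian l (\<gamma> t)) - (\<Sum>t<T. LINT \<gamma>|Q T. ?L t \<gamma>) + 6 * sqrt (real T)"
    using int integral_lagrangian_component(1)[OF _ l] expected_second_phase(1)
    by (simp add: Bochner_Integration.integral_sum Q.prob_space)
  also have "(\<Sum>t<T. LINT \<gamma>|Q T. lagrangian l (\<gamma> t)) \<le> (\<Sum>t<T. dual l)"
    using integral_lagrangian_component(2)[OF _ l] by (intro sum_mono) auto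
  also have "(\<Sum>t<T. dual l) = real T * dual l"
    by simp
  finally have "regret P T (bid_R2 T)
      \<le> real T * dual l - (\<Sum>t<T. LINT \<gamma>|Q T. ?L t \<gamma>) + 6 * sqrt (real T)"
    by simp
  moreover have "(\<Sum>t<T. dual_value * (1 - (LINT \<gamma>|Q T. exploring T t \<gamma>))) \<le> (\<Sum>t<T. LINT \<gamma>|Q T. ?L t \<gamma>)"
    using expected_second_phase(2) by (intro sum_mono) auto
  moreover have "(\<Sum>t<T. dual_value * (1 - (LINT \<gamma>|Q T. exploring T t \<gamma>))) =
      dual_value * (real T - (\<Sum>t<T. LINT \<gamma>|Q T. exploring T t \<gamma>))"
    by (simp add: sum_subtractf flip: sum_distrib_left)
  ultimately show ?thesis
    by linarith
qed

lemma regret_le_exploration: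
  assumes T: "1 \<le> T"
  shows "regret P T (bid_R2 T)
    \<le> dual_value * (\<Sum>t<T. LINT \<gamma>|Q T. exploring T t \<gamma>) + 6 * sqrt (real T)"
proof -
  define c where "c = dual_value * (real T - (\<Sum>t<T. LINT \<gamma>|Q T. exploring T t \<gamma>))"
  \<comment> \<open>Dividing by \<open>T\<close> turns the previous bound into a lower bound on
    \<open>dual\<close> valid for all positive \<open>l\<close>, hence on its infimum. The
    second-phase rounds then cancel.\<close>
  have "(regret P T (bid_R2 T) + c - 6 * sqrt (real T)) / real T \<le> (INF l\<in>{0<..}. dual l)"
  proof (rule cINF_greatest)
    fix l :: real assume "l \<in> {0<..}"
    then show "(regret P T (bid_R2 T) + c - 6 * sqrt (real T)) / real T \<le> dual l"
      using regret_le_dual[of l T] T by (simp add: c_def pos_divide_le_eq mult.commute)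
  qed auto
  then have "regret P T (bid_R2 T) + c - 6 * sqrt (real T) \<le> dual_value * real T"
    using T by (simp add: pos_divide_le_eq flip: dual_value_def)
  then show ?thesis
    by (simp add: c_def algebra_simps)
qed

lemma regret_bid_R2:
  assumes T: "2 \<le> T" and \<beta>: "0 < expected_slack P"
  shows "regret P T (bid_R2 T) \<le> (8 / expected_slack P + 12) * sqrt (real T) * ln (real T)"
proof -
  let ?p = "\<Sum>t<T. LINT \<gamma>|Q T. exploring T t \<gamma>" and ?s = "sqrt (real T) * ln (real T)"
  \<comment> \<open>The lower bound 1/2 on the logarithm absorbs lower-order terms: the threshold
    plus 1 is at most \<open>4 * ?s\<close>, and \<open>6 * sqrt T\<close> is at most
    \<open>12 * ?s\<close>.\<close>
  have "2 / 3 \<le> ln (real T)"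
    using ln2_ge_two_thirds T by (meson ln_le_cancel_iff less_le_trans numeral_le_real_of_nat_iff
        order_trans zero_less_numeral)
  then have ln: "1 / 2 \<le> ln (real T)"
    by simp
  have sqrt: "sqrt (real T) \<le> 2 * ?s"
    using mult_left_mono[OF ln, of "sqrt (real T)"] by simp
  have "1 \<le> sqrt (real T)"
    using T by simp
  then have thr: "threshold T + 1 \<le> 4 * ?s"
    using sqrt by linarith
  have "expected_slack P * ?p \<le> 4 * ?s"
    using order_trans[OF expected_first_phase thr] T by simp
  then have "?p \<le> 4 * ?s / expected_slack P"
    using \<beta> by (simp add: pos_le_divide_eq mult.commute)
  moreover have "0 \<le> ?p"
    by (intro sum_nonneg Bochner_Integration.integral_nonneg) (simp add: exploring_def)
  \<comment> \<open>The multiplier 1 gives the bound 2, which turns the 4 above into the 8 of the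
    constant.\<close>
  moreover have "dual_value \<le> 2"
    using dual_value_le[of 1] dual_bounds(2)[of 1] by simp
  ultimately have "dual_value * ?p \<le> 2 * (4 * ?s / expected_slack P)"
    by (intro mult_mono) auto
  moreover have "1 \<le> T"
    using T by simp
  ultimately have "regret P T (bid_R2 T) \<le> 2 * (4 * ?s / expected_slack P) + 12 * ?s"
    using regret_le_exploration[of T] sqrt by linarith
  then show ?thesis
    by (simp add: algebra_simps)
qed

end

theorem theorem4p1:
  fixes \<beta> :: real
  assumes "\<beta> > 0"
  shows "\<exists>C::real. \<forall>(P :: request measure) (T :: nat).
    request_distribution P \<longrightarrow> expected_slack P = \<beta> \<longrightarrow> T \<ge> 2 \<longrightarrow>
      integrable (\<Pi>\<^sub>M t\<in>{..<T}. P) (sample_regret T (bid_R2 T)) \<and>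
      regret P T (bid_R2 T) \<le> C * sqrt (real T) * ln (real T) \<and>
      (\<forall>\<gamma>\<in>space (\<Pi>\<^sub>M t\<in>{..<T}. P). satisfies_RoS T \<gamma> (bid_R2 T \<gamma>))"
proof (intro exI[of _ "8 / \<beta> + 12"] allI impI conjI)
  fix P :: "request measure" and T :: nat
  assume P: "request_distribution P" and slack: "expected_slack P = \<beta>" and T: "2 \<le> T"
  interpret iid_requests P
    by unfold_locales (rule P)
  show "integrable (\<Pi>\<^sub>M t\<in>{..<T}. P) (sample_regret T (bid_R2 T))"
    by (rule integrable_sample_regret)
  show "regret P T (bid_R2 T) \<le> (8 / \<beta> + 12) * sqrt (real T) * ln (real T)"
    using regret_bid_R2[OF T] assms slack by simp
  show "\<forall>\<gamma>\<in>space (\<Pi>\<^sub>M t\<in>{..<T}. P). satisfies_RoS T \<gamma> (bid_R2 T \<gamma>)"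
    using satisfies_RoS_bid_R2[OF truthful_Q T] by blast
qed

end
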